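(* Let $n\ge1$. The type $C$ zeta map $(\pi,\sigma)\mapsto\zeta(\pi,\sigma)$ is a bijection from the set of vertically $\mathfrak H_n$-labelled lattice paths onto the set of diagonally $\mathfrak H_n$-labelled ballot paths, and $\operatorname{dinv}'(\pi,\sigma)=\operatorname{area}'(\zeta(\pi,\sigma))$ for every vertically $\mathfrak H_n$-labelled path $(\pi,\sigma)$.
   Context: $\mathfrak H_n$: signed permutations (bijections $\sigma$ of $\{\pm1,\dots,\pm n\}$ with $\sigma(-k)=-\sigma(k)$), $\sigma_i=\sigma(i)$. $\mathcal L_{n,n}$: lattice paths $(0,0)\to(n,n)$ with steps $N=(0,1)$, $E=(1,0)$. $i$ is a rise if the $i$-th North step is followed by a North step; $(i,j)$ is a valley if the $i$-th East step is followed by the $j$-th North step. A vertically $\mathfrak H_n$-labelled path is $(\pi,\sigma)$ with $\pi\in\mathcal L_{n,n}$, $\sigma\in\mathfrak H_n$, $\sigma_i<\sigma_{i+1}$ for each rise $i$, and $\sigma_1>0$ if $\pi$ starts with a North step; $\sigma_i$ labels row $i$ (the $i$-th North step). Type $C$ area vector: $a_i=i-b_i$, $b_i$ the $x$-coordinate of the $i$-th North step. $\operatorname{dinv}'(\pi,\sigma)=\#\{(i,j):i<j,a_i=a_j,\sigma_i<\sigma_j\}+\#\{(i,j):i<j,a_i=a_j+1,\sigma_i>\sigma_j\}+\#\{(i,j):i<j,a_i=-a_j,\sigma_i<-\sigma_j\}+\#\{(i,j):i<j,a_i=-a_j+1,\sigma_i>-\sigma_j\}+\#\{i:a_i=0,\sigma_i<0\}$.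 Ballot paths $\mathcal B_n$: paths from $(0,0)$ with $2n$ steps in $\{N,E\}$ never below $x=y$. For $\tau\in\mathfrak H_n$, $w^\tau$ is the word with $w^\tau_i=\tau(n+1-i)$ for $1\le i\le n$ and $w^\tau_i=\tau(n-i)$ for $n+1\le i\le 2n$. A diagonally $\mathfrak H_n$-labelled ballot path is $(\beta,w^\tau)$ with $\beta\in\mathcal B_n$ such that $w^\tau_i>w^\tau_j$ for every valley $(i,j)$ of $\beta$ and $w^\tau_i>0$ if the final step of $\beta$ is its $i$-th East step. $\operatorname{area}'(\beta,w)$ is the number of pairs $(i,j)$ with $1\le i<j$, $i+j\le 2n+1$, such that $\beta$ has at least $j$ North steps, its $j$-th North step has $x$-coordinate at most $i-1$, and $w_i>w_j$. The map $\zeta_C$ on paths: given area vector $(a_1,\dots,a_n)$, start at $(0,0)$ with $i=n$; read the area vector left to right drawing $E$ for each entry $-i-1$ and $N$ for each entry $-i$, then right to left drawing $E$ for each entry $i+1$ and $N$ for each entry $i$; decrease $i$ by $1$ and repeat, stopping once $2n$ steps are drawn. The type $C$ zeta map: $\zeta(\pi,\sigma)=(\beta,w)$ with $\beta=\zeta_C(\pi)$, and $w$ built as follows: for $i=n,n-1,\dots,1$, append the labels $\sigma_k$ of the rows $k$ with $a_k=i$ read from top to bottom (decreasing $k$), then append the negatives $-\sigma_k$ of the labels of rows $k$ with $a_k=-i+1$ read from bottom to top (increasing $k$); this gives $u_1,\dots,u_n$, and $w=(u_1,\dots,u_n,-u_n,\dots,-u_1)$. *)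

theory Defs
  imports "HOL-Combinatorics.Permutations"
begin

text \<open>
  Rows, steps and letters are numbered from 1, as on paper; positions in the underlying lists are
  numbered from 0.
\<close>

definition signed_perms :: "nat \<Rightarrow> (int \<Rightarrow> int) set" where
  "signed_perms n = {\<sigma>. \<sigma> permutes {k. 1 \<le> \<bar>k\<bar> \<and> \<bar>k\<bar> \<le> int n} \<and>
      (\<forall>k. 1 \<le> \<bar>k\<bar> \<and> \<bar>k\<bar> \<le> int n \<longrightarrow> \<sigma> (- k) = - \<sigma> k)}"

datatype step = North | East

type_synonym path = "step list"

definition square_paths :: "nat \<Rightarrow> path set" where
  "square_paths n = {p. count_list p North = n \<and> count_list p East = n}"

definition ballot_paths :: "nat \<Rightarrow> path set" where
  "ballot_paths n = {p. length p = 2 * n \<and>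
      (\<forall>m \<le> length p. count_list (take m p) East \<le> count_list (take m p) North)}"

text \<open>\<open>kth_step_at p s k m\<close>: the step at list position \<open>m\<close> is the \<open>k\<close>-th step of kind \<open>s\<close>.\<close>

definition kth_step_at :: "path \<Rightarrow> step \<Rightarrow> nat \<Rightarrow> nat \<Rightarrow> bool" where
  "kth_step_at p s k m \<longleftrightarrow> m < length p \<and> p ! m = s \<and> count_list (take (Suc m) p) s = k"

definition is_rise :: "path \<Rightarrow> nat \<Rightarrow> bool" where
  "is_rise p i \<longleftrightarrow> (\<exists>m. kth_step_at p North i m \<and> Suc m < length p \<and> p ! Suc m = North)"

definition is_valley :: "path \<Rightarrow> nat \<Rightarrow> nat \<Rightarrow> bool" where
  "is_valley p i j \<longleftrightarrow> (\<exists>m. kth_step_at p East i m \<and> kth_step_at p North j (Suc m))"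

text \<open>Only meaningful if \<open>p\<close> has at least \<open>k \<ge> 1\<close> North steps.\<close>

definition north_x :: "path \<Rightarrow> nat \<Rightarrow> nat" where
  "north_x p k = count_list (take (THE m. kth_step_at p North k m) p) East"

definition area_entry :: "path \<Rightarrow> nat \<Rightarrow> int" where
  "area_entry p i = int i - int (north_x p i)"

definition area_vector :: "nat \<Rightarrow> path \<Rightarrow> int list" where
  "area_vector n p = map (area_entry p) [1..<Suc n]"

definition vert_labelled_paths :: "nat \<Rightarrow> (path \<times> (int \<Rightarrow> int)) set" where
  "vert_labelled_paths n = {(p, \<sigma>). p \<in> square_paths n \<and> \<sigma> \<in> signed_perms n \<and>
      (\<forall>i. is_rise p i \<longrightarrow> \<sigma> (int i) < \<sigma> (int i + 1)) \<and>
      (p \<noteq> [] \<and> hd p = North \<longrightarrow> \<sigma> 1 > 0)}"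

definition dinv' :: "nat \<Rightarrow> path \<times> (int \<Rightarrow> int) \<Rightarrow> nat" where
  "dinv' n = (\<lambda>(p, \<sigma>). let a = area_entry p; l = (\<lambda>i. \<sigma> (int i)) in
      card {(i, j). 1 \<le> i \<and> i < j \<and> j \<le> n \<and> a i = a j \<and> l i < l j} +
      card {(i, j). 1 \<le> i \<and> i < j \<and> j \<le> n \<and> a i = a j + 1 \<and> l i > l j} +
      card {(i, j). 1 \<le> i \<and> i < j \<and> j \<le> n \<and> a i = - a j \<and> l i < - l j} +
      card {(i, j). 1 \<le> i \<and> i < j \<and> j \<le> n \<and> a i = - a j + 1 \<and> l i > - l j} +
      card {i. 1 \<le> i \<and> i \<le> n \<and> a i = 0 \<and> l i < 0})"

definition signed_word :: "nat \<Rightarrow> (int \<Rightarrow> int) \<Rightarrow> int list" where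
  "signed_word n \<tau> =
      map (\<lambda>i. if i \<le> n then \<tau> (int n + 1 - int i) else \<tau> (int n - int i)) [1..<Suc (2 * n)]"

definition letter :: "int list \<Rightarrow> nat \<Rightarrow> int" where
  "letter w i = w ! (i - 1)"

definition diag_labelled_ballot_paths :: "nat \<Rightarrow> (path \<times> int list) set" where
  "diag_labelled_ballot_paths n = {(\<beta>, w). \<beta> \<in> ballot_paths n \<and>
      (\<exists>\<tau> \<in> signed_perms n. w = signed_word n \<tau>) \<and>
      (\<forall>i j. is_valley \<beta> i j \<longrightarrow> letter w i > letter w j) \<and>
      (\<forall>i. kth_step_at \<beta> East i (length \<beta> - 1) \<longrightarrow> letter w i > 0)}"

definition area' :: "nat \<Rightarrow> path \<times> int list \<Rightarrow> nat" where
  "area' n = (\<lambda>(\<beta>, w). card {(i, j). 1 \<le> i \<and> i < j \<and> i + j \<le> 2 * n + 1 \<and>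
      j \<le> count_list \<beta> North \<and> north_x \<beta> j \<le> i - 1 \<and> letter w i > letter w j})"

definition draw_steps :: "int \<Rightarrow> int \<Rightarrow> int list \<Rightarrow> path" where
  "draw_steps e m xs =
      concat (map (\<lambda>x. if x = e then [East] else if x = m then [North] else []) xs)"

definition zeta_round :: "int list \<Rightarrow> int \<Rightarrow> path" where
  "zeta_round a i = draw_steps (- i - 1) (- i) a @ draw_steps (i + 1) i (rev a)"

text \<open>
  The rounds \<open>i = n, n - 1, \<dots>, 0\<close> draw exactly \<open>2 * n\<close> steps (see \<open>length_zeta_path\<close> below), so
  the rule ``stop once \<open>2 * n\<close> steps are drawn'' amounts to stopping after round \<open>0\<close>.
\<close>

definition zeta_path :: "nat \<Rightarrow> path \<Rightarrow> path" where
  "zeta_path n p = concat (map (zeta_round (area_vector n p)) (rev [0..int n]))"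

definition zeta_half_word :: "nat \<Rightarrow> path \<Rightarrow> (int \<Rightarrow> int) \<Rightarrow> int list" where
  "zeta_half_word n p \<sigma> = concat (map (\<lambda>i.
      map (\<lambda>k. \<sigma> (int k)) (filter (\<lambda>k. area_entry p k = i) (rev [1..<Suc n])) @
      map (\<lambda>k. - \<sigma> (int k)) (filter (\<lambda>k. area_entry p k = - i + 1) [1..<Suc n]))
    (rev [1..int n]))"

definition zeta_word :: "nat \<Rightarrow> path \<Rightarrow> (int \<Rightarrow> int) \<Rightarrow> int list" where
  "zeta_word n p \<sigma> = (let u = zeta_half_word n p \<sigma> in u @ map uminus (rev u))"

definition zeta :: "nat \<Rightarrow> path \<times> (int \<Rightarrow> int) \<Rightarrow> path \<times> int list" where
  "zeta n = (\<lambda>(p, \<sigma>). (zeta_path n p, zeta_word n p \<sigma>))"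

lemma length_draw_steps:
  "length (draw_steps e m xs) = (\<Sum>x\<leftarrow>xs. if x = e \<or> x = m then 1 else 0)"
  by (induction xs) (auto simp: draw_steps_def)

lemma sum_list_zeta_rounds:
  fixes x :: int
  assumes "- int n \<le> x" "x \<le> int n"
  shows "(\<Sum>i\<in>{0..int n}. (if x = - i - 1 \<or> x = - i then 1 else 0) +
            (if x = i + 1 \<or> x = i then 1 else 0)) = (2 :: nat)"
proof -
  have *: "(\<Sum>i\<in>{0..int n}. if P i then 1 else 0) = card {i \<in> {0..int n}. P i}" for P
    by (simp add: sum.If_cases Int_def)
  have "{i \<in> {0..int n}. x = - i - 1 \<or> x = - i} =
      (if x < 0 then {- x - 1, - x} else if x = 0 then {0} else {})"
    using assms by auto
  moreover have "{i \<in> {0..int n}. x = i + 1 \<or> x = i} =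
      (if x > 0 then {x - 1, x} else if x = 0 then {0} else {})"
    using assms by auto
  ultimately show ?thesis
    by (simp only: sum.distrib *) auto
qed

lemma length_zeta_path:
  assumes "p \<in> square_paths n"
  shows "length (zeta_path n p) = 2 * n"
proof -
  have bound: "- int n \<le> x \<and> x \<le> int n" if "x \<in> set (area_vector n p)" for x
  proof -
    have x_le: "north_x p k \<le> n" for k
    proof -
      let ?m = "THE m. kth_step_at p North k m"
      have "count_list (take ?m p) East + count_list (drop ?m p) East = count_list p East"
        by (metis append_take_drop_id count_list_append)
      with assms show ?thesis by (simp add: north_x_def square_paths_def)
    qed
    from that obtain k where "k < Suc n" "x = int k - int (north_x p k)"
      by (auto simp: area_vector_def area_entry_def simp del: upt_Suc)
    with x_le[of k] show ?thesis by auto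
  qed
  have "length (zeta_path n p) = (\<Sum>i\<in>{0..int n}. length (zeta_round (area_vector n p) i))"
    by (simp add: zeta_path_def length_concat rev_map[symmetric] comp_def sum_list_rev
        sum_list_distinct_conv_sum_set)
  also have "\<dots> = (\<Sum>i\<in>{0..int n}. \<Sum>x\<leftarrow>area_vector n p.
      (if x = - i - 1 \<or> x = - i then 1 else 0) + (if x = i + 1 \<or> x = i then 1 else 0))"
    by (simp only: zeta_round_def length_append length_draw_steps rev_map[symmetric] sum_list_rev
        sum_list_addf)
  also have "\<dots> = (\<Sum>x\<leftarrow>area_vector n p. \<Sum>i\<in>{0..int n}.
      (if x = - i - 1 \<or> x = - i then 1 else 0) + (if x = i + 1 \<or> x = i then 1 else 0))"
    by (induction ("area_vector n p")) (simp_all add: sum.distrib)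
  also have "\<dots> = (\<Sum>x\<leftarrow>area_vector n p. 2)"
    using bound sum_list_zeta_rounds by (intro arg_cong[where f = sum_list] map_cong) auto
  also have "\<dots> = 2 * n"
    by (simp add: sum_list_triv) (simp add: area_vector_def del: upt_Suc)
  finally show ?thesis .
qed

end

theory Submission
  imports Defs
begin

text \<open>
  Extend the area vector and the labels to rows \<open>k \<in> {\<plusminus>1, \<dots>, \<plusminus>n}\<close> by \<open>a(-k) = 1 - a(k)\<close> and
  \<open>\<sigma>(-k) = -\<sigma>(k)\<close>. Give row \<open>k\<close> a North event at time \<open>(a(k), k)\<close> and an East event at time
  \<open>(a(k) - 1, k)\<close>, ordered lexicographically; negating times exchanges the two events of \<open>k\<close> and
  \<open>-k\<close>. The path \<open>\<zeta>\<^sub>C(\<pi>)\<close> lists the events of positive time in decreasing order, and \<open>w\<close> lists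
  the labels \<open>\<sigma>(k)\<close> by decreasing \<open>(a(k), k)\<close>, so the \<open>i\<close>-th North and East steps both belong to the
  row carrying \<open>w\<^sub>i\<close>.

  Both statistics count orbits of \<open>(k, l) \<mapsto> (-l, -k)\<close> on the pairs with \<open>\<sigma>(k) > \<sigma>(l)\<close> and the North
  event of \<open>k\<close> before that of \<open>l\<close> before the East event of \<open>k\<close>; only the choice of
  representatives differs. Valleys of \<open>\<zeta>\<^sub>C(\<pi>)\<close> are exactly consecutive rows \<open>l\<close>, \<open>k\<close> with
  \<open>a(k) = a(l) + 1\<close>, so the two labelling conditions agree. Finally \<open>\<zeta>\<^sub>C\<close> is injective, because the
  path determines the interleaving of any two adjacent levels, and there are as many ballot paths
  as lattice paths in the square.
\<close>

section \<open>Steps of lattice paths\<close>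

lemma step_neq_iff: "s \<noteq> North \<longleftrightarrow> s = East" "s \<noteq> East \<longleftrightarrow> s = North"
  by (cases s; simp)+

instance step :: finite
proof
  have "(UNIV :: step set) = {North, East}" using step_neq_iff by auto
  then show "finite (UNIV :: step set)" by (rule ssubst) (intro finite.intros)
qed

lemma length_eq_count_steps: "length p = count_list p North + count_list p East"
  by (induction p) (auto simp: step_neq_iff)

lemma count_list_take_mono: "m \<le> m' \<Longrightarrow> count_list (take m xs) x \<le> count_list (take m' xs) x"
  by (metis count_list_append le_add1 le_add_diff_inverse take_add)

lemma count_list_take_Suc:
  "m < length xs \<Longrightarrow> count_list (take (Suc m) xs) x = count_list (take m xs) x + (if xs ! m = x then 1 else 0)"
  by (simp add: take_Suc_conv_app_nth)

lemma kth_step_at_mono: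
  assumes "kth_step_at p s k m" "kth_step_at p s k' m'" "m < m'"
  shows "k < k'"
  using assms count_list_take_mono[of "Suc m" m' p s]
  by (auto simp: kth_step_at_def count_list_take_Suc)

lemma kth_step_at_less_iff:
  assumes "kth_step_at p s k m" "kth_step_at p s k' m'"
  shows "m < m' \<longleftrightarrow> k < k'"
  using kth_step_at_mono[OF assms] kth_step_at_mono[OF assms(2,1)] assms
  by (metis kth_step_at_def linorder_neqE_nat order_less_imp_not_less)

lemma kth_step_at_unique:
  assumes "kth_step_at p s k m" "kth_step_at p s k m'"
  shows "m = m'"
  using kth_step_at_less_iff[OF assms] kth_step_at_less_iff[OF assms(2,1)] by simp

lemma kth_step_at_bounds:
  assumes "kth_step_at p s k m"
  shows "1 \<le> k" "k \<le> count_list p s"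
  using assms count_list_take_mono[of "Suc m" "length p" p s]
  by (auto simp: kth_step_at_def count_list_take_Suc)

lemma kth_step_at_exists:
  assumes "1 \<le> k" "k \<le> count_list p s"
  shows "\<exists>m. kth_step_at p s k m"
  using assms
proof (induction p rule: rev_induct)
  case (snoc x p)
  show ?case
  proof (cases "k \<le> count_list p s")
    case True
    with snoc obtain m where "kth_step_at p s k m" by blast
    then have "kth_step_at (p @ [x]) s k m" by (auto simp: kth_step_at_def nth_append)
    then show ?thesis ..
  next
    case False
    with snoc.prems have "kth_step_at (p @ [x]) s k (length p)"
      by (auto simp: kth_step_at_def split: if_splits)
    then show ?thesis ..
  qed
qed simp

lemma kth_step_at_north_x:
  assumes "kth_step_at p North k m"
  shows "north_x p k = count_list (take m p) East"
  unfolding north_x_def using assms kth_step_at_unique by (metis (mono_tags) the_equality)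

text \<open>The \<open>m\<close> steps before the \<open>k\<close>-th North step are
  \<open>k - 1\<close> North and \<open>m - k + 1\<close> East steps. Knowing an area entry
  therefore amounts to knowing a position.\<close>

lemma area_entry_position:
  assumes "kth_step_at p North k m"
  shows "area_entry p k = 2 * int k - int m - 1"
  using assms length_eq_count_steps[of "take m p"] kth_step_at_north_x[OF assms]
  by (auto simp: area_entry_def kth_step_at_def count_list_take_Suc)

lemma filter_nth_take:
  assumes "m < length xs" "P (xs ! m)"
  shows "filter P xs ! length (filter P (take m xs)) = xs ! m"
  using assms by (subst (1) id_take_nth_drop[OF assms(1)]) (simp add: nth_append)

text \<open>The zeta path will be read off from a list of labelled steps; this finds the label of
  its \<open>i\<close>-th step of a kind. The index \<open>i - 1\<close> converts numbering from 1
  to list positions.\<close>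

lemma kth_step_at_map_fst:
  fixes es :: "(step \<times> 'a) list"
  assumes "kth_step_at (map fst es) s i m"
  shows "es ! m = (s, map snd (filter (\<lambda>e. fst e = s) es) ! (i - 1))"
proof -
  have m: "m < length es" and s: "fst (es ! m) = s"
    using assms by (auto simp: kth_step_at_def)
  have count: "count_list (map fst xs) s = length (filter (\<lambda>e. fst e = s) xs)"
    for xs :: "(step \<times> 'a) list"
    by (induction xs) auto
  have i: "i = Suc (length (filter (\<lambda>e. fst e = s) (take m es)))"
    using assms m s by (simp add: kth_step_at_def take_Suc_conv_app_nth take_map count)
  have "length (filter (\<lambda>e. fst e = s) es) = length (filter (\<lambda>e. fst e = s) (take m es)) +
      Suc (length (filter (\<lambda>e. fst e = s) (drop (Suc m) es)))"
    using s arg_cong[OF id_take_nth_drop[OF m], of "\<lambda>xs. length (filter (\<lambda>e. fst e = s) xs)"]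
    by simp
  then show ?thesis
    using filter_nth_take[OF m, of "\<lambda>e. fst e = s"] s i by (auto simp: prod_eq_iff)
qed

section \<open>Counting ballot paths\<close>

definition walk_height :: "path \<Rightarrow> int" where
  "walk_height q = int (count_list q North) - int (count_list q East)"

definition stays_above :: "int \<Rightarrow> path \<Rightarrow> bool" where
  "stays_above h q \<longleftrightarrow> (\<forall>m \<le> length q. 0 \<le> h + walk_height (take m q))"

lemma stays_above_Cons:
  "stays_above h (s # q) \<longleftrightarrow> 0 \<le> h \<and> stays_above (if s = North then h + 1 else h - 1) q"
proof -
  have "(\<forall>m \<le> Suc k. P m) \<longleftrightarrow> P 0 \<and> (\<forall>m \<le> k. P (Suc m))" for k P
    using All_less_Suc2[of "Suc k" P] by (simp add: less_Suc_eq_le)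
  then show ?thesis
    by (auto simp: stays_above_def walk_height_def step_neq_iff algebra_simps)
qed

lemma card_lists_Suc:
  "card {q :: path. length q = Suc m \<and> P q} =
    card {q. length q = m \<and> P (North # q)} + card {q. length q = m \<and> P (East # q)}"
proof -
  have fin: "finite {q :: path. length q = m \<and> Q q}" for Q
    using finite_lists_length_eq[of "UNIV :: step set" m] by (auto intro: finite_subset[rotated])
  have "{q :: path. length q = Suc m \<and> P q} =
      (#) North ` {q. length q = m \<and> P (North # q)} \<union> (#) East ` {q. length q = m \<and> P (East # q)}"
    (is "?A = ?B")
  proof (intro equalityI subsetI)
    fix q assume "q \<in> ?A"
    then show "q \<in> ?B" by (cases q; cases "hd q") auto
  qed auto
  then show ?thesis using fin by (simp only:) (subst card_Un_disjoint; auto simp: card_image)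
qed

text \<open>Both sides satisfy the recurrence \<open>f (m + 1) h = f m (h + 1) + f m (h - 1)\<close> and vanish at
  \<open>h = -1\<close>.\<close>

lemma card_stays_above:
  assumes "-1 \<le> h"
  shows "card {q. length q = m \<and> stays_above h q} =
    card {q. length q = m \<and> - h \<le> walk_height q \<and> walk_height q \<le> h + 1}"
  using assms
proof (induction m arbitrary: h)
  case 0
  then show ?case
    by (cases "h = -1") (auto simp: stays_above_def walk_height_def intro!: arg_cong[where f = card])
next
  case (Suc m)
  let ?I = "\<lambda>b c. {q. length q = m \<and> b \<le> walk_height q \<and> walk_height q \<le> c}"
  have fin: "finite {q :: path. length q = m \<and> Q q}" for Q
    using finite_lists_length_eq[of "UNIV :: step set" m] by (auto intro: finite_subset[rotated])
  have step: "walk_height (North # q) = walk_height q + 1" "walk_height (East # q) = walk_height q - 1"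
    for q by (simp_all add: walk_height_def)
  show ?case
  proof (cases "h = -1")
    case True
    then have "{q. length q = Suc m \<and> stays_above h q} = {}"
      by (auto simp: stays_above_def walk_height_def)
    moreover have "{q. length q = Suc m \<and> - h \<le> walk_height q \<and> walk_height q \<le> h + 1} = {}"
      using True by auto
    ultimately show ?thesis by (simp only:)
  next
    case False
    with Suc.prems have h: "0 \<le> h" by simp
    have "card {q. length q = Suc m \<and> stays_above h q} = card (?I (- h - 1) (h + 2)) + card (?I (1 - h) h)"
      using h Suc.IH[of "h + 1"] Suc.IH[of "h - 1"]
      by (simp add: card_lists_Suc stays_above_Cons diff_diff_eq[symmetric] add.commute[of 2 h])
    \<comment> \<open>The heights in \<open>(h, h + 2]\<close> move from the first interval to the
      second. What results is \<open>[-h, h + 1]\<close> shifted down by one and up by one, as a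
      first step North or East requires.\<close>
    also have "\<dots> = card (?I (- h - 1) h) + card (?I (1 - h) (h + 2))"
    proof -
      let ?J = "{q. length q = m \<and> h < walk_height q \<and> walk_height q \<le> h + 2}"
      have "?I (- h - 1) (h + 2) = ?I (- h - 1) h \<union> ?J" "?I (1 - h) (h + 2) = ?I (1 - h) h \<union> ?J"
        using h by auto
      moreover have "card (?I (- h - 1) h \<union> ?J) = card (?I (- h - 1) h) + card ?J"
        "card (?I (1 - h) h \<union> ?J) = card (?I (1 - h) h) + card ?J"
        by (intro card_Un_disjoint fin; auto)+
      ultimately show ?thesis by simp
    qed
    also have "\<dots> = card {q. length q = Suc m \<and> - h \<le> walk_height q \<and> walk_height q \<le> h + 1}"
    proof -
      have "{q. length q = m \<and> - h \<le> walk_height (North # q) \<and> walk_height (North # q) \<le> h + 1} =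
          ?I (- h - 1) h"
        "{q. length q = m \<and> - h \<le> walk_height (East # q) \<and> walk_height (East # q) \<le> h + 1} =
          ?I (1 - h) (h + 2)"
        by (auto simp: step)
      then show ?thesis by (simp only: card_lists_Suc)
    qed
    finally show ?thesis .
  qed
qed

lemma card_ballot_paths: "card (ballot_paths n) = card (square_paths n)"
proof -
  have "ballot_paths n = {q. length q = 2 * n \<and> stays_above 0 q}"
    by (auto simp: ballot_paths_def stays_above_def walk_height_def)
  \<comment> \<open>A path of even length cannot end at height 1, so the interval
    \<open>[0, 1]\<close> leaves only the balanced paths.\<close>
  moreover have "square_paths n = {q. length q = 2 * n \<and> - 0 \<le> walk_height q \<and> walk_height q \<le> 0 + 1}"
    by (auto simp: square_paths_def walk_height_def length_eq_count_steps)
  ultimately show ?thesis using card_stays_above[of 0 "2 * n"] by simp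
qed

lemma finite_ballot_paths: "finite (ballot_paths n)"
  using finite_lists_length_eq[of "UNIV :: step set" "2 * n"]
  by (auto simp: ballot_paths_def intro: finite_subset[rotated])

section \<open>Injectivity on paths\<close>

locale square_path =
  fixes n :: nat and p :: path
  assumes n_pos: "1 \<le> n" and square: "p \<in> square_paths n"
begin

lemma length_path: "length p = 2 * n"
  using square by (simp add: square_paths_def length_eq_count_steps)

lemma north_position:
  assumes "1 \<le> i" "i \<le> n"
  obtains m where "kth_step_at p North i m" "m < 2 * n"
  using kth_step_at_exists[of i p North] assms square length_path
  by (auto simp: square_paths_def kth_step_at_def)

text \<open>If consecutive North steps sit at positions \<open>m < m'\<close>, the area entry
  changes by \<open>2 - (m' - m)\<close>. The extreme value 1 means adjacent positions, which is how
  \<open>is_rise_iff\<close> recognises rises.\<close>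

lemma area_step_le:
  assumes "1 \<le> i" "i < n"
  shows "area_entry p (Suc i) \<le> area_entry p i + 1"
proof -
  obtain m where m: "kth_step_at p North i m" using north_position[of i] assms by auto
  obtain m' where m': "kth_step_at p North (Suc i) m'" using north_position[of "Suc i"] assms by auto
  have "m < m'" using kth_step_at_less_iff[OF m m'] by simp
  then show ?thesis using area_entry_position[OF m] area_entry_position[OF m'] by simp
qed

lemma is_rise_iff:
  "is_rise p i \<longleftrightarrow> 1 \<le> i \<and> i < n \<and> area_entry p (Suc i) = area_entry p i + 1"
proof
  assume "is_rise p i"
  then obtain m where m: "kth_step_at p North i m" "Suc m < length p" "p ! Suc m = North"
    by (auto simp: is_rise_def)
  then have m': "kth_step_at p North (Suc i) (Suc m)"
    by (auto simp: kth_step_at_def count_list_take_Suc)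
  show "1 \<le> i \<and> i < n \<and> area_entry p (Suc i) = area_entry p i + 1"
    using kth_step_at_bounds[OF m(1)] kth_step_at_bounds[OF m'] square
      area_entry_position[OF m(1)] area_entry_position[OF m']
    by (simp add: square_paths_def)
next
  assume i: "1 \<le> i \<and> i < n \<and> area_entry p (Suc i) = area_entry p i + 1"
  obtain m where m: "kth_step_at p North i m" using north_position[of i] i by auto
  obtain m' where m': "kth_step_at p North (Suc i) m'" using north_position[of "Suc i"] i by auto
  have "m' = Suc m" using i area_entry_position[OF m] area_entry_position[OF m'] by simp
  with m m' show "is_rise p i"
    unfolding is_rise_def by (intro exI[of _ m]) (simp add: kth_step_at_def)
qed

lemma area_entry_1_le: "area_entry p 1 \<le> 1"
  by (simp add: area_entry_def)

lemma hd_North_iff: "hd p = North \<longleftrightarrow> area_entry p 1 = 1"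
proof -
  obtain m where m: "kth_step_at p North 1 m" using north_position[of 1] n_pos by auto
  have "hd p = North \<longleftrightarrow> m = 0"
  proof
    assume "hd p = North"
    then have "kth_step_at p North 1 0"
      using length_path n_pos by (cases p) (auto simp: kth_step_at_def)
    then show "m = 0" using kth_step_at_unique m by blast
  next
    assume "m = 0"
    with m show "hd p = North" by (cases p) (auto simp: kth_step_at_def)
  qed
  then show ?thesis using area_entry_position[OF m] by auto
qed

lemma area_entry_bounds:
  assumes "1 \<le> i" "i \<le> n"
  shows "int i - int n \<le> area_entry p i" "area_entry p i \<le> int n"
proof -
  obtain m where m: "kth_step_at p North i m" using north_position[of i] assms by auto
  have "north_x p i \<le> n"
    using kth_step_at_north_x[OF m] count_list_take_mono[of m "length p" p East] square m
    by (auto simp: square_paths_def kth_step_at_def)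
  then show "int i - int n \<le> area_entry p i" "area_entry p i \<le> int n"
    using assms by (auto simp: area_entry_def)
qed

lemma length_area_vector: "length (area_vector n p) = n"
  by (simp add: area_vector_def del: upt_Suc)

lemma area_vector_nth: "i < n \<Longrightarrow> area_vector n p ! i = area_entry p (Suc i)"
  by (simp add: area_vector_def del: upt_Suc)

end

text \<open>By \<open>area_entry_position\<close> the area vector fixes the positions of the North
  steps, and every other step is East.\<close>

lemma area_vector_inj: "inj_on (area_vector n) (square_paths n)"
proof (rule inj_onI)
  fix p q assume pq: "p \<in> square_paths n" "q \<in> square_paths n" and eq: "area_vector n p = area_vector n q"
  \<comment> \<open>Stated for arbitrary \<open>p\<close> and \<open>q\<close>, so that it can also
    be applied with the two paths exchanged.\<close>
  have sub: "q ! m = North" if "p \<in> square_paths n" "q \<in> square_paths n"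
    "area_vector n p = area_vector n q" "m < 2 * n" "p ! m = North" for p q m
  proof -
    have n: "1 \<le> n" using that by simp
    interpret p: square_path n p using that n by unfold_locales
    interpret q: square_path n q using that n by unfold_locales
    have i: "kth_step_at p North (count_list (take (Suc m) p) North) m" (is "kth_step_at _ _ ?i _")
      using that p.length_path by (simp add: kth_step_at_def)
    have ib: "1 \<le> ?i" "?i \<le> n" using kth_step_at_bounds[OF i] that by (auto simp: square_paths_def)
    obtain m' where m': "kth_step_at q North ?i m'" using q.north_position ib by blast
    have "area_entry p ?i = area_entry q ?i"
      using p.area_vector_nth[of "?i - 1"] q.area_vector_nth[of "?i - 1"] ib that(3) by simp
    then have "m = m'" using area_entry_position[OF i] area_entry_position[OF m'] by simp
    then show ?thesis using m' by (simp add: kth_step_at_def)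
  qed
  have len: "length p = 2 * n" "length q = 2 * n"
    using pq by (auto simp: square_paths_def length_eq_count_steps)
  show "p = q"
  proof (rule nth_equalityI)
    fix m assume "m < length p"
    then show "p ! m = q ! m"
      using sub[OF pq eq, of m] sub[OF pq(2,1) eq[symmetric], of m] len by (metis step.exhaust)
  qed (simp add: len)
qed

section \<open>Slowly growing sequences and their pairs of adjacent levels\<close>

abbreviation level_pair :: "int \<Rightarrow> int list \<Rightarrow> int list" where
  "level_pair v \<equiv> filter (\<lambda>x. x = v \<or> x = v + 1)"

abbreviation slow_growth :: "int list \<Rightarrow> bool" where
  "slow_growth \<equiv> successively (\<lambda>x y. y \<le> x + 1)"

text \<open>A sequence that starts at or below \<open>v\<close> and never rises by more than 1
  cannot reach \<open>v + 1\<close> without passing through \<open>v\<close>.\<close>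

lemma level_pair_hd:
  assumes "slow_growth xs" "level_pair v xs = y # ys" "hd xs \<le> v"
  shows "y = v"
  using assms
proof (induction xs)
  case (Cons x xs)
  show ?case
  proof (cases "x = v")
    case False
    with Cons.prems have x: "x < v" "level_pair v xs = y # ys" by auto
    then have "xs \<noteq> []" by auto
    with Cons x show ?thesis by (auto simp: successively_Cons)
  qed (use Cons.prems in auto)
qed simp

text \<open>The sequence is recovered entry by entry. Were the heads \<open>x < y\<close>, the pair
  of levels \<open>y - 1\<close>, \<open>y\<close> would begin with \<open>y\<close> in one
  sequence, but with \<open>y - 1\<close> in the other by \<open>level_pair_hd\<close>. Equal heads
  can be deleted from all pairs.\<close>

lemma slow_growth_eqI:
  assumes "slow_growth xs" "slow_growth ys" "\<And>v. level_pair v xs = level_pair v ys"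
  shows "xs = ys"
  using assms
proof (induction xs arbitrary: ys)
  case Nil
  then show ?case by (cases ys) (auto, metis list.distinct(1))
next
  case (Cons x xs)
  obtain y ys' where ys: "ys = y # ys'"
    using Cons.prems(3)[of x] by (cases ys) auto
  have xy: "x = y"
  proof (rule linorder_cases[of x y])
    assume "x < y"
    moreover have "level_pair (y - 1) (x # xs) = y # level_pair (y - 1) ys'"
      using Cons.prems(3)[of "y - 1"] ys by simp
    ultimately show ?thesis using level_pair_hd[OF Cons.prems(1), of "y - 1" y] by auto
  next
    assume "y < x"
    moreover have "level_pair (x - 1) ys = x # level_pair (x - 1) xs"
      using Cons.prems(3)[of "x - 1"] by simp
    ultimately show ?thesis using level_pair_hd[OF Cons.prems(2), of "x - 1" x] ys by auto
  qed
  have "xs = ys'"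
  proof (rule Cons.IH)
    show "slow_growth xs" "slow_growth ys'"
      using Cons.prems(1,2) ys by (auto simp: successively_Cons)
    show "level_pair v xs = level_pair v ys'" for v
      using Cons.prems(3)[of v] xy ys by (auto split: if_splits)
  qed
  with xy ys show ?case by simp
qed

lemma draw_steps_level_pair:
  "draw_steps (v + 1) v xs = map (\<lambda>x. if x = v + 1 then East else North) (level_pair v xs)"
  by (induction xs) (auto simp: draw_steps_def)

lemma draw_steps_eqD:
  assumes "draw_steps (v + 1) v xs = draw_steps (v + 1) v ys"
  shows "level_pair v xs = level_pair v ys"
proof (rule map_inj_on)
  show "map (\<lambda>x. if x = v + 1 then East else North) (level_pair v xs) =
      map (\<lambda>x. if x = v + 1 then East else North) (level_pair v ys)"
    using assms by (simp only: draw_steps_level_pair)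
qed (auto simp: inj_on_def split: if_splits)

section \<open>Symmetrised level sequences and the blocks of the zeta path\<close>

definition reflect_levels :: "int list \<Rightarrow> int list" where
  "reflect_levels xs = map (\<lambda>x. 1 - x) (rev xs)"

text \<open>The reflection \<open>x \<mapsto> 1 - x\<close> carries the levels \<open>- v\<close>,
  \<open>1 - v\<close> to \<open>v + 1\<close>, \<open>v\<close>. In a symmetric sequence the pairs
  of negative index are thus mirror images of those of positive index.\<close>

lemma level_pair_reflect: "level_pair v (reflect_levels xs) = reflect_levels (level_pair (- v) xs)"
  by (induction xs) (auto simp: reflect_levels_def)

text \<open>The levels of the rows \<open>-n, ..., -1, 1, ..., n\<close> in this order.\<close>

definition symmetrize :: "int list \<Rightarrow> int list" where
  "symmetrize xs = reflect_levels xs @ xs"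

lemma reflect_symmetrize: "reflect_levels (symmetrize xs) = symmetrize xs"
  by (simp add: symmetrize_def reflect_levels_def rev_map comp_def)

text \<open>The second half of round \<open>v\<close> followed by the first half of round
  \<open>v - 1\<close>. Unlike a round, this reads a single pair of adjacent levels of a single
  sequence.\<close>

definition level_block :: "int list \<Rightarrow> int \<Rightarrow> path" where
  "level_block xs v = draw_steps (v + 1) v (rev (symmetrize xs))"

text \<open>The bound on \<open>hd xs\<close> keeps the growth slow across the junction of
  \<open>symmetrize xs\<close>, where \<open>1 - hd xs\<close> is followed by \<open>hd xs\<close>.
  The bound on \<open>last xs\<close> makes \<open>symmetrize xs\<close> start at level at most
  1.\<close>

definition square_area :: "nat \<Rightarrow> int list \<Rightarrow> bool" where
  "square_area n xs \<longleftrightarrow> xs \<noteq> [] \<and> length xs = n \<and> slow_growth xs \<and> hd xs \<le> 1 \<and> 0 \<le> last xs \<and>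
    (\<forall>x \<in> set xs. 1 - int n \<le> x \<and> x \<le> int n)"

lemma (in square_path) square_area_area_vector: "square_area n (area_vector n p)"
proof -
  have "slow_growth (area_vector n p)"
    unfolding successively_conv_nth using area_step_le by (auto simp: length_area_vector area_vector_nth)
  moreover have ne: "area_vector n p \<noteq> []" using length_area_vector n_pos by auto
  moreover have "hd (area_vector n p) \<le> 1"
    using area_entry_1_le n_pos ne by (simp add: hd_conv_nth area_vector_nth)
  moreover have "0 \<le> last (area_vector n p)"
    using area_entry_bounds(1)[of n] n_pos ne by (simp add: last_conv_nth length_area_vector area_vector_nth)
  moreover have "1 - int n \<le> x \<and> x \<le> int n" if "x \<in> set (area_vector n p)" for x
  proof -
    obtain i where "1 \<le> i" "i \<le> n" "x = area_entry p i"
      using \<open>x \<in> _\<close> by (auto simp: area_vector_def simp del: upt_Suc)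
    then show ?thesis using area_entry_bounds[of i] by auto
  qed
  ultimately show ?thesis by (simp add: square_area_def length_area_vector)
qed

lemma slow_growth_symmetrize:
  assumes "square_area n xs"
  shows "slow_growth (symmetrize xs)"
proof -
  have "slow_growth (reflect_levels xs)"
    using assms unfolding reflect_levels_def square_area_def
    by (auto simp: successively_map successively_rev elim: successively_mono)
  then show ?thesis using assms
    by (auto simp: symmetrize_def successively_append_iff square_area_def reflect_levels_def
        last_map last_rev)
qed

lemma level_block_conv:
  "level_block xs v = draw_steps (v + 1) v (rev xs) @ draw_steps (- v) (1 - v) xs"
proof -
  have "draw_steps (v + 1) v (map (\<lambda>x. 1 - x) xs) = draw_steps (- v) (1 - v) xs"
    by (induction xs) (auto simp: draw_steps_def)
  then show ?thesis
    by (simp add: level_block_def symmetrize_def reflect_levels_def rev_map) (simp add: draw_steps_def)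
qed

text \<open>Shifts the bracketing by half a round: the second half \<open>g i\<close> joins the
  first half \<open>f (i - 1)\<close> of the next round.\<close>

lemma regroup_rounds:
  fixes f g :: "int \<Rightarrow> 'a list"
  shows "g (int n + 1) @ concat (map (\<lambda>i. f i @ g i) (rev [0..int n])) =
    concat (map (\<lambda>i. g i @ f (i - 1)) (rev [1..int n + 1])) @ g 0"
proof (induction n)
  case (Suc n)
  have "[0..int (Suc n)] = [0..int n] @ [int n + 1]" "[1..int (Suc n) + 1] = [1..int n + 1] @ [int n + 2]"
    by (simp_all add: upto_rec2 algebra_simps)
  with Suc show ?case by (simp add: algebra_simps)
qed simp

lemma zeta_path_conv_blocks:
  assumes "square_area n (area_vector n p)"
  shows "zeta_path n p = concat (map (level_block (area_vector n p)) (rev [1..int n + 1])) @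
    draw_steps (0 + 1) 0 (rev (area_vector n p))"
proof -
  let ?a = "area_vector n p"
  \<comment> \<open>No entry exceeds \<open>n\<close>, so the half round that completes the top
    block \<open>n + 1\<close> is empty.\<close>
  have "draw_steps (int n + 2) (int n + 1) (rev ?a) = []"
    using assms by (fastforce simp: draw_steps_def square_area_def)
  then show ?thesis
    using regroup_rounds[of "\<lambda>i. draw_steps (i + 1) i (rev ?a)" n "\<lambda>i. draw_steps (- i - 1) (- i) ?a"]
    by (simp add: zeta_path_def zeta_round_def[abs_def] level_block_conv[abs_def] algebra_simps)
qed

text \<open>The segment between the two cuts is the end of the longer prefix, so it ends in North
  unless empty. Equal North counts of the suffixes leave no North step in it.\<close>

lemma append_eq_if_north_end:
  assumes "x @ y = x' @ y'" "x = [] \<or> last x = North" "x' = [] \<or> last x' = North"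
    "count_list y North = count_list y' North"
  shows "x = x' \<and> y = y'"
proof -
  have *: "z = []" if "z = [] \<or> last z = North" "count_list z North = 0" for z
    using that by (metis count_list_0_iff last_in_set)
  obtain z where "x = x' @ z \<and> z @ y = y' \<or> x @ z = x' \<and> y = z @ y'"
    using assms(1) by (auto simp: append_eq_append_conv2)
  moreover from this have "count_list z North = 0" using assms(4) by auto
  moreover have "z = [] \<or> last z = North" using calculation(1) assms(2,3)
    by (metis append_is_Nil_conv last_appendR)
  ultimately show ?thesis using *[of z] by auto
qed

text \<open>Blocks read the sequence backwards, so their last step comes from the first entry on
  level \<open>v\<close> or \<open>v + 1\<close>. The sequence starts at level at most 1, so
  \<open>level_pair_hd\<close> makes this entry \<open>v\<close>.\<close>

lemma level_block_north_end:
  assumes "square_area n xs" "1 \<le> v"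
  shows "level_block xs v = [] \<or> last (level_block xs v) = North"
proof (cases "level_pair v (symmetrize xs)")
  case (Cons y ys)
  have "hd (symmetrize xs) \<le> 1"
    using assms by (auto simp: square_area_def symmetrize_def reflect_levels_def hd_append hd_map hd_rev)
  then have "y = v"
    using level_pair_hd[OF slow_growth_symmetrize[OF assms(1)] Cons] assms(2) by simp
  with Cons show ?thesis
    by (simp add: level_block_def draw_steps_level_pair rev_filter[symmetric])
qed (simp add: level_block_def draw_steps_level_pair rev_filter[symmetric])

lemma count_level_block:
  "count_list (level_block xs v) North = count_list (symmetrize xs) v"
  "count_list (level_block xs v) East = count_list (symmetrize xs) (v + 1)"
proof -
  have "count_list (draw_steps (v + 1) v ys) North = count_list ys v \<and>
    count_list (draw_steps (v + 1) v ys) East = count_list ys (v + 1)" for ys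
    by (induction ys) (auto simp: draw_steps_def)
  then show "count_list (level_block xs v) North = count_list (symmetrize xs) v"
    "count_list (level_block xs v) East = count_list (symmetrize xs) (v + 1)"
    by (simp_all add: level_block_def)
qed

lemma concat_blocks_north_end:
  assumes "square_area n xs" "1 \<le> j"
  shows "concat (map (level_block xs) (rev [j..k])) = [] \<or>
    last (concat (map (level_block xs) (rev [j..k]))) = North"
proof -
  have "concat bs = [] \<or> last (concat bs) = North" if "\<forall>b \<in> set bs. b = [] \<or> last b = North" for bs
    using that by (induction bs) (auto simp: last_append)
  moreover have "b = [] \<or> last b = North" if b: "b \<in> set (map (level_block xs) (rev [j..k]))" for b
    proof -
    obtain v where "b = level_block xs v" "1 \<le> v" using b assms(2) by auto
    then show ?thesis using level_block_north_end[OF assms(1)] by simp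
  qed
  ultimately show ?thesis by blast
qed

text \<open>Each entry \<open>x\<close> of \<open>xs\<close> contributes \<open>x\<close> and
  \<open>1 - x\<close> to the symmetrised sequence, and exactly one of the two is at least
  1.\<close>

lemma count_blocks_north:
  assumes "square_area n xs"
  shows "count_list (concat (map (level_block xs) (rev [1..int n + 1]))) North = n"
proof -
  have "count_list (concat (map (level_block xs) vs)) North =
      length (filter (\<lambda>x. x \<in> set vs) (symmetrize xs))" if "distinct vs" for vs
    using that
  proof (induction vs)
    case (Cons v vs)
    have "length (filter (\<lambda>x. x \<in> set (v # vs)) ys) =
        count_list ys v + length (filter (\<lambda>x. x \<in> set vs) ys)" for ys
      using Cons.prems by (induction ys) auto
    with Cons show ?case by (simp add: count_level_block del: set_simps)
  qed simp
  then have "count_list (concat (map (level_block xs) (rev [1..int n + 1]))) North =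
      length (filter (\<lambda>x. x \<in> {1..int n + 1}) (symmetrize xs))"
    by (simp del: atLeastAtMost_iff)
  also have "\<dots> = length xs"
  proof -
    have "\<forall>x \<in> set xs. 1 - int n \<le> x \<and> x \<le> int n" using assms by (simp add: square_area_def)
    then have "length (filter (\<lambda>x. x \<in> {1..int n + 1}) (map (\<lambda>x. 1 - x) xs)) +
        length (filter (\<lambda>x. x \<in> {1..int n + 1}) xs) = length xs"
      by (induction xs) auto
    then show ?thesis by (simp add: symmetrize_def reflect_levels_def rev_map rev_filter[symmetric])
  qed
  finally show ?thesis using assms by (simp add: square_area_def)
qed

text \<open>The block structure is recovered from the end: the prefix through the \<open>n\<close>-th North step
  consists of the blocks of level at least 1, the length of the rest is the number of North steps in
  block 1, and the number of East steps in block \<open>v\<close> is the number of North steps in block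
  \<open>v + 1\<close>.\<close>

lemma zeta_path_inj:
  assumes "1 \<le> n"
  shows "inj_on (zeta_path n) (square_paths n)"
proof (rule inj_onI)
  fix p q assume pq: "p \<in> square_paths n" "q \<in> square_paths n" and eq: "zeta_path n p = zeta_path n q"
  interpret p: square_path n p using assms pq by unfold_locales
  interpret q: square_path n q using assms pq by unfold_locales
  define a b where "a = area_vector n p" and "b = area_vector n q"
  have a: "square_area n a" and b: "square_area n b"
    using p.square_area_area_vector q.square_area_area_vector by (simp_all add: a_def b_def)
  define A B where "A v = concat (map (level_block a) (rev [v..int n + 1]))"
    and "B v = concat (map (level_block b) (rev [v..int n + 1]))" for v
  have za: "zeta_path n p = A 1 @ draw_steps (0 + 1) 0 (rev a)"
    and zb: "zeta_path n q = B 1 @ draw_steps (0 + 1) 0 (rev b)"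
    using zeta_path_conv_blocks[of n p] zeta_path_conv_blocks[of n q] a b
    by (simp_all add: a_def b_def A_def B_def)
  have ends: "A v = [] \<or> last (A v) = North" "B v = [] \<or> last (B v) = North" if "1 \<le> v" for v
    unfolding A_def B_def by (intro concat_blocks_north_end[OF a that] concat_blocks_north_end[OF b that])+
  have start: "A 1 = B 1 \<and> draw_steps (0 + 1) 0 (rev a) = draw_steps (0 + 1) 0 (rev b)"
  proof (rule append_eq_if_north_end)
    show same: "A 1 @ draw_steps (0 + 1) 0 (rev a) = B 1 @ draw_steps (0 + 1) 0 (rev b)"
      using eq za zb by simp
    have "count_list (A 1) North = count_list (B 1) North"
      using count_blocks_north[OF a] count_blocks_north[OF b] by (simp add: A_def B_def)
    then show "count_list (draw_steps (0 + 1) 0 (rev a)) North = count_list (draw_steps (0 + 1) 0 (rev b)) North"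
      using arg_cong[OF same, of "\<lambda>x. count_list x North"] by simp
  qed (use ends in auto)
  \<comment> \<open>The tail has an East step for each entry 1 and a North step for each entry 0,
    and an entry 0 reflects to an entry 1.\<close>
  have len: "length (draw_steps (0 + 1) 0 (rev xs)) = count_list (symmetrize xs) 1" for xs
  proof -
    have "length (draw_steps (0 + 1) 0 ys) = count_list (map (\<lambda>x. 1 - x) ys) 1 + count_list ys 1" for ys
      by (induction ys) (auto simp: draw_steps_def)
    from this[of "rev xs"] show ?thesis by (simp add: symmetrize_def reflect_levels_def)
  qed
  have peel: "level_block a v = level_block b v \<and> A (v + 1) = B (v + 1)"
    if "A v = B v" "count_list (symmetrize a) v = count_list (symmetrize b) v" "1 \<le> v" "v \<le> int n + 1" for v
  proof -
    have "A v = A (v + 1) @ level_block a v" "B v = B (v + 1) @ level_block b v"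
      using that(4) by (simp_all only: A_def B_def upto_rec1[of v "int n + 1"]) simp_all
    with that(1) have "A (v + 1) @ level_block a v = B (v + 1) @ level_block b v" by metis
    from append_eq_if_north_end[OF this] that ends[of "v + 1"] show ?thesis
      unfolding count_level_block by auto
  qed
  have "A v = B v \<and> count_list (symmetrize a) v = count_list (symmetrize b) v" if "1 \<le> v" "v \<le> int n + 1" for v
    using that
  proof (induction v rule: int_ge_induct)
    case base
    then show ?case using start len[of a] len[of b] by simp
  next
    case (step v)
    then have "level_block a v = level_block b v" "A (v + 1) = B (v + 1)" using peel[of v] by auto
    then show ?case using count_level_block(2)[of a v] count_level_block(2)[of b v] by metis
  qed
  then have blocks: "level_block a v = level_block b v" if "1 \<le> v" "v \<le> int n + 1" for v
    using peel that by blast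
  have high: "level_pair v (symmetrize a) = level_pair v (symmetrize b)" if v: "1 \<le> v" for v
  proof (cases "v \<le> int n + 1")
    case True
    then show ?thesis
      using draw_steps_eqD[of v "rev (symmetrize a)" "rev (symmetrize b)"] blocks[OF v]
      by (simp add: level_block_def rev_filter[symmetric])
  next
    case False
    have "level_pair v (symmetrize xs) = []" if "square_area n xs" for xs
      using that False by (fastforce simp: square_area_def symmetrize_def reflect_levels_def filter_empty_conv)
    then show ?thesis using a b by simp
  qed
  \<comment> \<open>Pairs of negative index are reflected to positive index. The pair 0 reflects to
    itself: its positive rows come from the tail of the path, its negative rows from their
    reflection.\<close>
  have "level_pair v (symmetrize a) = level_pair v (symmetrize b)" for v
  proof -
    consider "1 \<le> v" | "v = 0" | "1 \<le> - v" by linarith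
    then show ?thesis
    proof cases
      case 2
      have "level_pair 0 a = level_pair 0 b"
        using draw_steps_eqD[of 0 "rev a" "rev b"] start by (simp add: rev_filter[symmetric])
      then show ?thesis using 2 level_pair_reflect[of 0 a] level_pair_reflect[of 0 b]
        by (simp add: symmetrize_def)
    next
      case 3
      then show ?thesis using high[of "- v"] level_pair_reflect[of v "symmetrize a"]
          level_pair_reflect[of v "symmetrize b"] by (simp only: reflect_symmetrize)
    qed (rule high)
  qed
  then have "symmetrize a = symmetrize b"
    by (rule slow_growth_eqI[OF slow_growth_symmetrize[OF a] slow_growth_symmetrize[OF b]])
  then have "a = b" using a b by (simp add: symmetrize_def square_area_def reflect_levels_def)
  then show "p = q" using area_vector_inj pq by (auto simp: a_def b_def inj_on_def)
qed

section \<open>Events in time order\<close>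

lemma sorted_wrt_concat_map:
  assumes "\<And>i. i \<in> set is \<Longrightarrow> sorted_wrt P (f i)"
    and "sorted_wrt (\<lambda>i j. \<forall>x \<in> set (f i). \<forall>y \<in> set (f j). P x y) is"
  shows "sorted_wrt P (concat (map f is))"
  using assms by (induction "is") (auto simp: sorted_wrt_append)

section \<open>Lists strictly decreasing under an integer key\<close>

abbreviation decreasing_by :: "('a \<Rightarrow> int) \<Rightarrow> 'a list \<Rightarrow> bool" where
  "decreasing_by f \<equiv> sorted_wrt (\<lambda>x y. f y < f x)"

lemma decreasing_by_unique:
  assumes "decreasing_by f xs" "decreasing_by f ys" "set xs = set ys"
  shows "xs = ys"
  using assms
proof (induction xs arbitrary: ys)
  case (Cons x xs)
  obtain y ys' where ys: "ys = y # ys'" using Cons.prems(3) by (cases ys) auto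
  have "x = y"
  proof (rule ccontr)
    assume "x \<noteq> y"
    then have "x \<in> set ys'" "y \<in> set xs" using Cons.prems(3) ys by auto
    then have "f x < f y" "f y < f x" using Cons.prems(1,2) ys by auto
    then show False by simp
  qed
  moreover have "x \<notin> set xs" "y \<notin> set ys'" using Cons.prems(1,2) ys by auto
  ultimately have "set xs = set ys'" using Cons.prems(3) ys by (auto simp: insert_eq_iff)
  then show ?case using Cons.IH[of ys'] Cons.prems(1,2) ys \<open>x = y\<close> by simp
qed simp

lemma decreasing_by_nth_less_iff:
  assumes "decreasing_by f xs" "i < length xs" "j < length xs"
  shows "f (xs ! j) < f (xs ! i) \<longleftrightarrow> i < j"
proof (rule linorder_cases[of i j])
  assume "i < j"
  then show ?thesis using sorted_wrt_nth_less[OF assms(1), of i j] assms by simp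
next
  assume "j < i"
  then show ?thesis using sorted_wrt_nth_less[OF assms(1), of j i] assms by simp
qed simp

lemma decreasing_by_distinct: "decreasing_by f xs \<Longrightarrow> distinct xs"
  by (induction xs) auto

lemma decreasing_by_filter: "decreasing_by f xs \<Longrightarrow> decreasing_by f (filter P xs)"
  by (induction xs) auto

text \<open>The entries with key above \<open>c\<close> form a prefix, so comparing a key with
  \<open>c\<close> is comparing a position with the length of that prefix. This converts step counts
  into key inequalities.\<close>

lemma decreasing_by_threshold:
  assumes "decreasing_by f xs" "i < length xs"
  shows "c < f (xs ! i) \<longleftrightarrow> i < length (filter (\<lambda>x. c < f x) xs)"
  using assms
proof (induction xs arbitrary: i)
  case (Cons x xs)
  show ?case
  proof (cases "c < f x")
    case True
    then show ?thesis using Cons by (cases i) auto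
  next
    case False
    then have small: "\<not> c < f y" if "y \<in> set (x # xs)" for y
      using Cons.prems(1) that by fastforce
    then have "filter (\<lambda>x. c < f x) (x # xs) = []" by (simp only: filter_empty_conv) blast
    then have "length (filter (\<lambda>x. c < f x) (x # xs)) = 0" by (simp only: list.size)
    moreover have "\<not> c < f ((x # xs) ! i)" using small Cons.prems(2) nth_mem by blast
    ultimately show ?thesis by simp
  qed
qed simp

lemma decreasing_by_filter_nth:
  assumes "decreasing_by f xs" "i < length (filter (\<lambda>x. c < f x) xs)"
  shows "filter (\<lambda>x. c < f x) xs ! i = xs ! i"
  using assms
proof (induction xs arbitrary: i)
  case (Cons x xs)
  show ?case
  proof (cases "c < f x")
    case True
    then show ?thesis using Cons by (cases i) auto
  next
    case False
    then have "filter (\<lambda>x. c < f x) (x # xs) = []"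
      using Cons.prems(1) by (fastforce simp: filter_empty_conv)
    with Cons.prems(2) show ?thesis by (metis less_nat_zero_code list.size(3))
  qed
qed simp

lemma decreasing_by_take:
  assumes "decreasing_by f xs" "m < length xs"
  shows "take m xs = filter (\<lambda>x. f (xs ! m) < f x) xs"
proof (rule decreasing_by_unique[OF _ decreasing_by_filter[OF assms(1)]])
  show "decreasing_by f (take m xs)" using assms(1) by (rule sorted_wrt_take)
  show "set (take m xs) = set (filter (\<lambda>x. f (xs ! m) < f x) xs)"
  proof (intro equalityI subsetI)
    fix x assume "x \<in> set (take m xs)"
    then obtain i where "i < m" "x = xs ! i" using assms(2) by (auto simp: in_set_conv_nth)
    then show "x \<in> set (filter (\<lambda>x. f (xs ! m) < f x) xs)"
      using assms decreasing_by_nth_less_iff[OF assms(1), of i m] by auto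
  next
    fix x assume x: "x \<in> set (filter (\<lambda>x. f (xs ! m) < f x) xs)"
    then obtain i where i: "i < length xs" "x = xs ! i" by (auto simp: in_set_conv_nth)
    with x have "i < m" using decreasing_by_nth_less_iff[OF assms(1), of i m] assms(2) by auto
    with i show "x \<in> set (take m xs)" using assms(2) by (auto simp: in_set_conv_nth)
  qed
qed

lemma decreasing_by_adjacent:
  assumes "decreasing_by f xs" "Suc m < length xs" "x \<in> set xs" "f x < f (xs ! m)"
  shows "f x \<le> f (xs ! Suc m)"
proof -
  obtain i where i: "i < length xs" "x = xs ! i" using assms(3) by (auto simp: in_set_conv_nth)
  then have "m < i" using decreasing_by_nth_less_iff[OF assms(1), of m i] assms by simp
  then show ?thesis
    using i decreasing_by_nth_less_iff[OF assms(1), of "Suc m" i] assms(2) by (cases "i = Suc m") auto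
qed

lemma decreasing_by_adjacentI:
  assumes "decreasing_by f xs" "x \<in> set xs" "y \<in> set xs" "f y < f x"
    and "\<And>z. z \<in> set xs \<Longrightarrow> f y < f z \<Longrightarrow> f z < f x \<Longrightarrow> False"
  obtains m where "Suc m < length xs" "xs ! m = x" "xs ! Suc m = y"
proof -
  obtain i j where ij: "i < length xs" "x = xs ! i" "j < length xs" "y = xs ! j"
    using assms(2,3) by (auto simp: in_set_conv_nth)
  then have "i < j" using decreasing_by_nth_less_iff[OF assms(1), of i j] assms(4) by simp
  have "\<not> Suc i < j"
  proof
    assume "Suc i < j"
    then show False
      using assms(5)[of "xs ! Suc i"] ij decreasing_by_nth_less_iff[OF assms(1), of i "Suc i"]
        decreasing_by_nth_less_iff[OF assms(1), of "Suc i" j] by simp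
  qed
  with \<open>i < j\<close> have "j = Suc i" by simp
  then show thesis using that ij by simp
qed

lemma decreasing_by_last:
  assumes "decreasing_by f xs" "x \<in> set xs" "xs \<noteq> []"
  shows "xs ! (length xs - 1) = x \<longleftrightarrow> (\<forall>y \<in> set xs. f x \<le> f y)"
proof -
  let ?m = "length xs - 1"
  have m: "?m < length xs" using assms(3) by simp
  have min: "f (xs ! ?m) \<le> f y" if y: "y \<in> set xs" for y
  proof -
    obtain i where "i < length xs" "y = xs ! i" using y by (auto simp: in_set_conv_nth)
    then show ?thesis using decreasing_by_nth_less_iff[OF assms(1) m, of i] by force
  qed
  obtain i where i: "i < length xs" "x = xs ! i" using assms(2) by (auto simp: in_set_conv_nth)
  show ?thesis
  proof
    assume "\<forall>y \<in> set xs. f x \<le> f y"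
    then have "f x \<le> f (xs ! ?m)" using m by simp
    then have "\<not> i < ?m" using decreasing_by_nth_less_iff[OF assms(1) i(1) m] i(2) by simp
    then have "i = ?m" using i(1) by simp
    then show "xs ! ?m = x" using i by simp
  qed (use min in auto)
qed

context square_path
begin

section \<open>Signed rows with their levels, keys and event times\<close>

definition rows :: "int set" where
  "rows = {k. 1 \<le> \<bar>k\<bar> \<and> \<bar>k\<bar> \<le> int n}"

definition level :: "int \<Rightarrow> int" where
  "level k = (if 0 < k then area_entry p (nat k) else 1 - area_entry p (nat (- k)))"

text \<open>Two rows differ by at most \<open>2 * n\<close>, so with this factor
  \<open>level k * width + k\<close> encodes the lexicographic order by level, then row, in one
  integer. Subtracting \<open>width\<close> lowers the level by 1.\<close>

abbreviation width :: int where
  "width \<equiv> 2 * int n + 1"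

definition key :: "int \<Rightarrow> int" where
  "key k = level k * width + k"

definition time :: "step \<times> int \<Rightarrow> int" where
  "time e = key (snd e) - (if fst e = East then width else 0)"

lemma minus_rows: "- k \<in> rows \<longleftrightarrow> k \<in> rows"
  by (simp add: rows_def)

lemma rows_cases:
  assumes "k \<in> rows"
  obtains i where "1 \<le> i" "i \<le> n" "k = int i" | i where "1 \<le> i" "i \<le> n" "k = - int i"
proof (cases "0 < k")
  case True
  then show thesis using that(1)[of "nat k"] assms by (auto simp: rows_def)
next
  case False
  then show thesis using that(2)[of "nat (- k)"] assms by (auto simp: rows_def)
qed

lemma finite_rows: "finite rows"
  by (rule finite_subset[of _ "{- int n..int n}"]) (auto simp: rows_def)

lemma level_int: "1 \<le> i \<Longrightarrow> level (int i) = area_entry p i"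
  by (simp add: level_def)

lemma level_minus: "k \<in> rows \<Longrightarrow> level (- k) = 1 - level k"
  by (auto simp: level_def rows_def)

text \<open>Equivalently, the North time of \<open>- k\<close> is the negative of the East time of
  \<open>k\<close>.\<close>

lemma key_minus: "k \<in> rows \<Longrightarrow> key (- k) = width - key k"
  by (simp add: key_def level_minus algebra_simps)

lemma level_bounds:
  assumes "k \<in> rows"
  shows "1 - int n \<le> level k" "level k \<le> int n"
proof -
  have "1 - int n \<le> level (int i) \<and> level (int i) \<le> int n" if "1 \<le> i" "i \<le> n" for i
    using area_entry_bounds[OF that] that by (simp add: level_int)
  moreover have "level (- int i) = 1 - level (int i)" if "1 \<le> i" "i \<le> n" for i
    using level_minus[of "int i"] that by (simp add: rows_def)
  ultimately have "1 - int n \<le> level k \<and> level k \<le> int n"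
    using assms by (elim rows_cases) force+
  then show "1 - int n \<le> level k" "level k \<le> int n" by simp_all
qed

lemma lex_less_iff:
  assumes "\<bar>k\<bar> \<le> int n" "\<bar>l\<bar> \<le> int n"
  shows "x * width + k < y * width + l \<longleftrightarrow> x < y \<or> x = y \<and> k < l"
proof -
  have *: "x * width + k < y * width + l" if "x < y" "\<bar>k\<bar> \<le> int n" "\<bar>l\<bar> \<le> int n" for x y k l
  proof -
    have "(x + 1) * width \<le> y * width" using that by (intro mult_right_mono) auto
    then show ?thesis using that by (simp add: algebra_simps)
  qed
  show ?thesis using *[of x y k l] *[of y x l k] assms by (cases x y rule: linorder_cases) auto
qed

lemma rows_abs_le: "k \<in> rows \<Longrightarrow> \<bar>k\<bar> \<le> int n"
  by (simp add: rows_def)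

lemma key_less_iff:
  assumes "k \<in> rows" "l \<in> rows"
  shows "key k < key l \<longleftrightarrow> level k < level l \<or> level k = level l \<and> k < l"
  unfolding key_def by (intro lex_less_iff rows_abs_le assms)

lemma key_less_shift_iff:
  assumes "k \<in> rows" "l \<in> rows"
  shows "key k < key l + width \<longleftrightarrow> level k < level l + 1 \<or> level k = level l + 1 \<and> k < l"
  using lex_less_iff[of k l "level k" "level l + 1"] assms by (simp add: key_def rows_abs_le algebra_simps)

lemma shift_key_less_iff:
  assumes "k \<in> rows" "l \<in> rows"
  shows "key l + width < key k \<longleftrightarrow> level l + 1 < level k \<or> level k = level l + 1 \<and> l < k"
  using lex_less_iff[of l k "level l + 1" "level k"] assms
  by (auto simp: key_def rows_abs_le algebra_simps)

lemma key_pos_iff: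
  assumes "k \<in> rows"
  shows "0 < key k \<longleftrightarrow> 0 < level k \<or> level k = 0 \<and> 0 < k"
  using lex_less_iff[of 0 k 0 "level k"] assms by (auto simp: key_def rows_abs_le)

lemma width_less_key_iff:
  assumes "k \<in> rows"
  shows "width < key k \<longleftrightarrow> 1 < level k \<or> level k = 1 \<and> 0 < k"
  using lex_less_iff[of 0 k 1 "level k"] assms by (auto simp: key_def rows_abs_le)

lemma key_eq_iff: "k \<in> rows \<Longrightarrow> l \<in> rows \<Longrightarrow> key k = key l \<longleftrightarrow> k = l"
  using key_less_iff[of k l] key_less_iff[of l k] by (metis linorder_neqE order_less_irrefl)

text \<open>A North and an East event never coincide in time: equality would make the rows equal and
  their levels differ by 1.\<close>

lemma key_neq_shift:
  assumes "k \<in> rows" "l \<in> rows"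
  shows "key k \<noteq> key l + width"
proof
  assume eq: "key k = key l + width"
  then have "\<not> key k < key l + width" "\<not> key l + width < key k" by auto
  then have "level k = level l + 1" "k = l"
    unfolding key_less_shift_iff[OF assms] shift_key_less_iff[OF assms] by auto
  then show False by simp
qed

section \<open>The reading order of the labels and the list of events\<close>

definition row_list :: "int list" where
  "row_list = map int [1..<Suc n]"

definition rows_desc :: "int list" where
  "rows_desc = rev row_list @ map uminus row_list"

text \<open>Within one level, \<open>rows_desc\<close> gives the positive rows from top to bottom
  and then the rows \<open>-k\<close> by increasing \<open>k\<close>, the order in which the word
  \<open>u\<close> is built.\<close>

definition half_order :: "int list" where
  "half_order = concat (map (\<lambda>i. filter (\<lambda>k. level k = i) rows_desc) (rev [1..int n]))"

definition reading_order :: "int list" where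
  "reading_order = half_order @ map uminus (rev half_order)"

definition events_at :: "int \<Rightarrow> int list \<Rightarrow> (step \<times> int) list" where
  "events_at v ks = concat (map (\<lambda>k. if level k = v + 1 then [(East, k)]
      else if level k = v then [(North, k)] else []) ks)"

text \<open>In round \<open>i\<close> the entries \<open>- i - 1\<close> and \<open>- i\<close> of
  row \<open>k\<close> are the levels \<open>i + 2\<close> and \<open>i + 1\<close> of row
  \<open>-k\<close>. The left-to-right pass is therefore time level \<open>i + 1\<close> on the
  negative rows, and the right-to-left pass is time level \<open>i\<close> on the positive
  rows.\<close>

definition events :: "(step \<times> int) list" where
  "events = concat (map (\<lambda>i. events_at (i + 1) (map uminus row_list) @ events_at i (rev row_list))
      (rev [0..int n]))"

lemma set_row_list: "set row_list = {1..int n}"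
  unfolding row_list_def by (auto simp: image_int_atLeastLessThan simp del: upt_Suc)

lemma sorted_row_list: "sorted_wrt (<) row_list"
  unfolding row_list_def by (simp add: sorted_wrt_map strict_sorted_iff[symmetric] del: upt_Suc)

lemma set_rows_desc: "set rows_desc = rows"
proof -
  have "k \<in> rows \<Longrightarrow> k \<notin> {1..int n} \<Longrightarrow> - k \<in> {1..int n}" for k by (auto simp: rows_def)
  then have "k \<in> rows \<Longrightarrow> k \<notin> {1..int n} \<Longrightarrow> k \<in> uminus ` {1..int n}" for k by force
  then show ?thesis by (auto simp: rows_desc_def set_row_list) (auto simp: rows_def)
qed

lemma length_rows_desc: "length rows_desc = 2 * n"
  by (simp add: rows_desc_def row_list_def del: upt_Suc)

lemma sorted_rows_desc: "sorted_wrt (>) rows_desc"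
  using sorted_row_list
  by (auto simp: rows_desc_def sorted_wrt_append sorted_wrt_rev sorted_wrt_map set_row_list)

lemma uminus_rev_rows_desc: "map uminus (rev rows_desc) = rows_desc"
  by (simp add: rows_desc_def rev_map comp_def)

lemma set_half_order: "set half_order = {k \<in> rows. 1 \<le> level k}"
  using level_bounds by (auto simp: half_order_def set_rows_desc)

lemma decreasing_half_order: "decreasing_by key half_order"
  unfolding half_order_def
proof (rule sorted_wrt_concat_map)
  fix i
  have "decreasing_by (\<lambda>k. k) (filter (\<lambda>k. level k = i) rows_desc)"
    using sorted_rows_desc by (rule sorted_wrt_filter)
  then show "decreasing_by key (filter (\<lambda>k. level k = i) rows_desc)"
    by (rule sorted_wrt_mono_rel[rotated]) (auto simp: key_def)
next
  show "sorted_wrt (\<lambda>i j. \<forall>x \<in> set (filter (\<lambda>k. level k = i) rows_desc).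
      \<forall>y \<in> set (filter (\<lambda>k. level k = j) rows_desc). key y < key x) (rev [1..int n])"
    unfolding sorted_wrt_rev by (rule sorted_wrt_mono_rel[of _ "(<)"]) (auto simp: set_rows_desc key_less_iff)
qed

lemma uminus_rev_reading_order: "map uminus (rev reading_order) = reading_order"
  by (simp add: reading_order_def rev_map comp_def)

lemma set_reading_order: "set reading_order = rows"
proof -
  have "k \<in> rows \<Longrightarrow> \<not> 1 \<le> level k \<Longrightarrow> k \<in> uminus ` {k \<in> rows. 1 \<le> level k}" for k
    using level_minus[of k] minus_rows[of k] by (intro image_eqI[of _ _ "- k"]) auto
  then show ?thesis by (auto simp: reading_order_def set_half_order minus_rows)
qed

text \<open>Negation reverses the order of keys, so the second half is decreasing as well. Its
  levels are at most 0, those of the first half at least 1.\<close>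

lemma decreasing_reading_order: "decreasing_by key reading_order"
proof -
  have "decreasing_by key (map uminus (rev half_order))"
    using decreasing_half_order unfolding sorted_wrt_map sorted_wrt_rev
    by (rule sorted_wrt_mono_rel[rotated]) (auto simp: set_half_order key_minus)
  moreover have "key (- l) < key k" if "k \<in> set half_order" "l \<in> set half_order" for k l
    using that by (auto simp: set_half_order key_less_iff minus_rows level_minus)
  ultimately show ?thesis
    using decreasing_half_order by (auto simp: reading_order_def sorted_wrt_append)
qed

lemma length_reading_order: "length reading_order = 2 * n"
proof -
  have "distinct reading_order" "distinct rows_desc"
    using decreasing_by_distinct[OF decreasing_reading_order] decreasing_by_distinct[of "\<lambda>k. k"]
      sorted_rows_desc by auto
  then have "length reading_order = length rows_desc"
    by (metis distinct_card set_reading_order set_rows_desc)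
  then show ?thesis by (simp add: length_rows_desc)
qed

lemma set_events_at:
  "set (events_at v ks) = {(s, k). k \<in> set ks \<and> level k = v + (if s = East then 1 else 0)}"
proof (intro set_eqI, clarify)
  show "(s, k) \<in> set (events_at v ks) \<longleftrightarrow>
      (s, k) \<in> {(s, k). k \<in> set ks \<and> level k = v + (if s = East then 1 else 0)}" for s k
    by (cases s; induction ks) (auto simp: events_at_def)
qed

lemma time_event:
  "level k = v + (if s = East then 1 else 0) \<Longrightarrow> time (s, k) = v * width + k"
  by (auto simp: time_def key_def algebra_simps)

lemma events_at_time:
  assumes "e \<in> set (events_at v ks)"
  shows "snd e \<in> set ks \<and> time e = v * width + snd e"
  using assms time_event[of "snd e" v "fst e"] by (auto simp: set_events_at)

lemma decreasing_events_at:
  assumes "sorted_wrt (>) ks"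
  shows "decreasing_by time (events_at v ks)"
  using assms
proof (induction ks)
  case (Cons k ks)
  have split: "events_at v (k # ks) = events_at v [k] @ events_at v ks" by (simp add: events_at_def)
  have "decreasing_by time (events_at v [k])" by (simp add: events_at_def)
  moreover have "time e' < time e" if "e \<in> set (events_at v [k])" "e' \<in> set (events_at v ks)" for e e'
    using events_at_time[OF that(1)] events_at_time[OF that(2)] Cons.prems by auto
  ultimately show ?case using Cons unfolding split sorted_wrt_append by simp
qed (simp add: events_at_def)

lemma decreasing_events: "decreasing_by time events"
  unfolding events_def
proof (rule sorted_wrt_concat_map)
  let ?r = "\<lambda>i. events_at (i + 1) (map uminus row_list) @ events_at i (rev row_list)"
  fix i :: int
  have "sorted_wrt (>) (map uminus row_list)" "sorted_wrt (>) (rev row_list)"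
    using sorted_row_list by (simp_all add: sorted_wrt_map sorted_wrt_rev)
  moreover have "time e' < time e" if "e \<in> set (events_at (i + 1) (map uminus row_list))"
    "e' \<in> set (events_at i (rev row_list))" for e e'
    using events_at_time[OF that(1)] events_at_time[OF that(2)] by (auto simp: set_row_list algebra_simps)
  ultimately show "decreasing_by time (?r i)"
    unfolding sorted_wrt_append by (blast intro: decreasing_events_at)
next
  let ?r = "\<lambda>i. events_at (i + 1) (map uminus row_list) @ events_at i (rev row_list)"
  \<comment> \<open>A time \<open>v * width + k\<close> lies just above \<open>v * width\<close> for
    a positive row and just below it for a negative one, so both passes of a round fall into the
    same window.\<close>
  have range: "i * width < time e \<and> time e < (i + 1) * width" if e: "e \<in> set (?r i)" for e i
  proof -
    from e have "e \<in> set (events_at (i + 1) (map uminus row_list)) \<or> e \<in> set (events_at i (rev row_list))"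
      by simp
    then show ?thesis by (auto dest!: events_at_time simp: set_row_list algebra_simps)
  qed
  have "time e' < time e" if "e \<in> set (?r j)" "e' \<in> set (?r i)" "i < j" for e e' i j
  proof -
    have "(i + 1) * width \<le> j * width" using that by (intro mult_right_mono) auto
    with range[OF that(1)] range[OF that(2)] show ?thesis by linarith
  qed
  then show "sorted_wrt (\<lambda>i j. \<forall>x \<in> set (?r i). \<forall>y \<in> set (?r j). time y < time x) (rev [0..int n])"
    unfolding sorted_wrt_rev by (intro sorted_wrt_mono_rel[OF _ sorted_wrt_upto]) blast
qed

lemma time_pos_iff:
  assumes "k \<in> rows" "level k = v + (if s = East then 1 else 0)"
  shows "0 < time (s, k) \<longleftrightarrow> 0 < v \<or> v = 0 \<and> 0 < k"
  using lex_less_iff[of 0 k 0 v] assms by (auto simp: time_event rows_abs_le)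

lemma set_events: "set events = {(s, k). k \<in> rows \<and> 0 < time (s, k)}"
proof (intro equalityI subsetI)
  fix e assume "e \<in> set events"
  then obtain i s k where e: "e = (s, k)" and i: "0 \<le> i"
    and "(s, k) \<in> set (events_at (i + 1) (map uminus row_list)) \<or> (s, k) \<in> set (events_at i (rev row_list))"
    unfolding events_def by auto (metis surj_pair)+
  then have "k \<in> rows \<and> level k = (i + 1) + (if s = East then 1 else 0) \<or>
      k \<in> rows \<and> 0 < k \<and> level k = i + (if s = East then 1 else 0)"
    by (auto simp: set_events_at set_row_list rows_def)
  then show "e \<in> {(s, k). k \<in> rows \<and> 0 < time (s, k)}"
    using i time_pos_iff[of k "i + 1" s] time_pos_iff[of k i s] unfolding e by auto
next
  fix e assume "e \<in> {(s, k). k \<in> rows \<and> 0 < time (s, k)}"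
  then obtain s k where e: "e = (s, k)" and k: "k \<in> rows" and t: "0 < time (s, k)" by auto
  define v where "v = level k - (if s = East then 1 else 0)"
  have v: "level k = v + (if s = East then 1 else 0)" by (simp add: v_def)
  have pos: "0 < v \<or> v = 0 \<and> 0 < k" using time_pos_iff[OF k v] t by simp
  have le: "v \<le> int n" using level_bounds[OF k] by (simp add: v_def)
  \<comment> \<open>An event of time level \<open>v\<close> is drawn in round \<open>v - 1\<close>
    if its row is negative and in round \<open>v\<close> if its row is positive.\<close>
  have "e \<in> set (events_at (v - 1 + 1) (map uminus row_list)) \<and> 0 \<le> v - 1 \<or> e \<in> set (events_at v (rev row_list))"
    using k pos v by (auto simp: e set_events_at set_row_list rows_def image_iff intro!: bexI[of _ "- k"])
  then show "e \<in> set events"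
  proof
    assume "e \<in> set (events_at (v - 1 + 1) (map uminus row_list)) \<and> 0 \<le> v - 1"
    then show ?thesis using le unfolding events_def by (auto intro!: bexI[of _ "v - 1"])
  next
    assume "e \<in> set (events_at v (rev row_list))"
    then show ?thesis using le pos unfolding events_def by (auto intro!: bexI[of _ v])
  qed
qed

lemma map_fst_events: "map fst events = zeta_path n p"
proof -
  have av: "area_vector n p = map level row_list"
    unfolding area_vector_def row_list_def by (simp add: level_int del: upt_Suc)
  have pos: "map fst (events_at v ks) = draw_steps (v + 1) v (map level ks)" for v ks
    by (induction ks) (auto simp: events_at_def draw_steps_def)
  have neg: "map fst (events_at (i + 1) (map uminus ks)) = draw_steps (- i - 1) (- i) (map level ks)"
    if "set ks \<subseteq> rows" for i ks
    using that by (induction ks) (auto simp: events_at_def draw_steps_def level_minus)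
  have "set row_list \<subseteq> rows" by (auto simp: set_row_list rows_def)
  then have "map fst (events_at (i + 1) (map uminus row_list) @ events_at i (rev row_list)) =
      zeta_round (area_vector n p) i" for i
    using neg[of row_list i] pos[of i "rev row_list"]
    by (simp only: zeta_round_def av map_append rev_map)
  then show ?thesis by (simp add: events_def zeta_path_def map_concat comp_def)
qed

lemma length_events: "length events = 2 * n"
  by (metis length_map map_fst_events length_zeta_path square)

text \<open>Among events of one kind, decreasing time means decreasing key. Hence the rows of each
  kind, in order of drawing, form a prefix of \<open>reading_order\<close>; \<open>max 0 c\<close>
  reflects that only events of positive time are drawn.\<close>

lemma event_labels:
  "map snd (filter (\<lambda>e. fst e = s \<and> c < time e) events) =
    filter (\<lambda>k. max 0 c + (if s = East then width else 0) < key k) reading_order"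
proof (rule decreasing_by_unique)
  show "decreasing_by key (map snd (filter (\<lambda>e. fst e = s \<and> c < time e) events))"
    unfolding sorted_wrt_map
  proof (rule sorted_wrt_mono_rel[OF _ decreasing_by_filter[OF decreasing_events]])
    show "key (snd y) < key (snd x)" if "x \<in> set (filter (\<lambda>e. fst e = s \<and> c < time e) events)"
      "y \<in> set (filter (\<lambda>e. fst e = s \<and> c < time e) events)" "time y < time x" for x y
      using that by (auto simp: time_def split: if_splits)
  qed
  show "decreasing_by key (filter (\<lambda>k. max 0 c + (if s = East then width else 0) < key k) reading_order)"
    by (rule decreasing_by_filter[OF decreasing_reading_order])
  show "set (map snd (filter (\<lambda>e. fst e = s \<and> c < time e) events)) =
      set (filter (\<lambda>k. max 0 c + (if s = East then width else 0) < key k) reading_order)"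
    by (auto simp: set_events set_reading_order time_def image_iff split: if_splits)
qed

end

section \<open>The statistics\<close>

lemma length_filter_mono:
  "(\<And>x. x \<in> set xs \<Longrightarrow> P x \<Longrightarrow> Q x) \<Longrightarrow> length (filter P xs) \<le> length (filter Q xs)"
  by (induction xs) auto

lemma card_pairs_bij:
  assumes "bij_betw g I R" "X \<subseteq> R \<times> R"
  shows "card {(i, j). i \<in> I \<and> j \<in> I \<and> (g i, g j) \<in> X} = card X"
proof (rule bij_betw_same_card)
  have inj: "inj_on g I" and img: "g ` I = R" using assms(1) by (auto simp: bij_betw_def)
  show "bij_betw (\<lambda>(i, j). (g i, g j)) {(i, j). i \<in> I \<and> j \<in> I \<and> (g i, g j) \<in> X} X"
    unfolding bij_betw_def
  proof (intro conjI equalityI subsetI)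
    show "inj_on (\<lambda>(i, j). (g i, g j)) {(i, j). i \<in> I \<and> j \<in> I \<and> (g i, g j) \<in> X}"
      using inj by (auto simp: inj_on_def)
    fix x assume x: "x \<in> X"
    then obtain i j where "i \<in> I" "j \<in> I" "x = (g i, g j)" using assms(2) img by (cases x) blast
    with x show "x \<in> (\<lambda>(i, j). (g i, g j)) ` {(i, j). i \<in> I \<and> j \<in> I \<and> (g i, g j) \<in> X}"
      by (intro image_eqI[of _ _ "(i, j)"]) auto
  qed auto
qed

text \<open>The involution \<open>h\<close> exchanges the points with \<open>0 < f\<close>,
  \<open>g < 0\<close> and those with \<open>f < 0\<close>, \<open>0 < g\<close>. All remaining
  points are counted on both sides or on neither.\<close>

lemma card_halves_eq:
  fixes f g :: "'a \<Rightarrow> int"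
  assumes fin: "finite F" and maps: "\<And>x. x \<in> F \<Longrightarrow> h x \<in> F" and inv: "\<And>x. x \<in> F \<Longrightarrow> h (h x) = x"
    and f: "\<And>x. x \<in> F \<Longrightarrow> f (h x) = - f x" and g: "\<And>x. x \<in> F \<Longrightarrow> g (h x) = - g x"
    and zero: "\<And>x. x \<in> F \<Longrightarrow> f x = 0 \<longleftrightarrow> g x = 0"
  shows "card {x \<in> F. 0 \<le> f x} = card {x \<in> F. 0 \<le> g x}"
proof -
  let ?B = "{x \<in> F. 0 \<le> f x \<and> 0 \<le> g x}"
  let ?P = "{x \<in> F. 0 < f x \<and> g x < 0}"
  let ?Q = "{x \<in> F. f x < 0 \<and> 0 < g x}"
  have "bij_betw h ?P ?Q"
    by (rule bij_betw_byWitness[of _ h]) (use maps inv f g in auto)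
  then have "card ?P = card ?Q" by (rule bij_betw_same_card)
  moreover have "{x \<in> F. 0 \<le> f x} = ?B \<union> ?P" "{x \<in> F. 0 \<le> g x} = ?B \<union> ?Q"
    using zero by (auto simp: order_le_less) (metis less_irrefl linorder_neqE)+
  moreover have "card (?B \<union> ?P) = card ?B + card ?P" "card (?B \<union> ?Q) = card ?B + card ?Q"
    using fin by (intro card_Un_disjoint; auto)+
  ultimately show ?thesis by simp
qed

lemma antisymmetric_list_nth:
  fixes xs :: "int list"
  assumes "map uminus (rev xs) = xs" "i < length xs"
  shows "xs ! (length xs - 1 - i) = - xs ! i"
proof -
  have "xs ! i = map uminus (rev xs) ! i" using assms(1) by simp
  also have "\<dots> = - xs ! (length xs - 1 - i)" using assms(2) by (simp add: rev_nth)
  finally show ?thesis by simp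
qed

context square_path
begin

lemma event_labels_all:
  "map snd (filter (\<lambda>e. fst e = s) events) =
    filter (\<lambda>k. (if s = East then width else 0) < key k) reading_order"
proof -
  have "filter (\<lambda>e. fst e = s) events = filter (\<lambda>e. fst e = s \<and> 0 < time e) events"
    by (rule filter_cong) (auto simp: set_events)
  then show ?thesis using event_labels[of s 0] by simp
qed

lemma count_filter_events:
  "count_list (map fst (filter (\<lambda>e. c < time e) events)) s =
    length (filter (\<lambda>k. max 0 c + (if s = East then width else 0) < key k) reading_order)"
proof -
  have "count_list (map fst es) s = length (filter (\<lambda>e. fst e = s) es)" for es :: "(step \<times> int) list"
    by (induction es) auto
  then have "count_list (map fst (filter (\<lambda>e. c < time e) events)) s =
      length (map snd (filter (\<lambda>e. fst e = s \<and> c < time e) events))"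
    by (simp add: conj_commute)
  then show ?thesis unfolding event_labels .
qed

lemma count_zeta_path:
  "count_list (zeta_path n p) s =
    length (filter (\<lambda>k. (if s = East then width else 0) < key k) reading_order)"
proof -
  have "filter (\<lambda>e. 0 < time e) events = events" by (rule filter_True) (auto simp: set_events)
  then show ?thesis using count_filter_events[of 0 s] by (simp add: map_fst_events)
qed

lemma distinct_reading_order: "distinct reading_order"
  by (rule decreasing_by_distinct[OF decreasing_reading_order])

lemma reading_order_in_rows: "i < 2 * n \<Longrightarrow> reading_order ! i \<in> rows"
  using set_reading_order length_reading_order nth_mem by metis

text \<open>The rows of either kind form a prefix of \<open>reading_order\<close>, so the
  \<open>i\<close>-th North and the \<open>i\<close>-th East step share the row at index
  \<open>i - 1\<close>. Conversely, distinctness of \<open>reading_order\<close> recovers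
  \<open>i\<close> from the row.\<close>

lemma kth_step_iff:
  "kth_step_at (zeta_path n p) s i m \<longleftrightarrow>
    m < 2 * n \<and> 1 \<le> i \<and> i \<le> 2 * n \<and> events ! m = (s, reading_order ! (i - 1))"
proof -
  have fwd: "m < 2 * n \<and> 1 \<le> i \<and> i \<le> 2 * n \<and> events ! m = (s, reading_order ! (i - 1))"
    if kth: "kth_step_at (zeta_path n p) s i m" for i
  proof -
    let ?P = "\<lambda>k. (if s = East then width else 0) < key k"
    have i: "1 \<le> i" "i \<le> length (filter ?P reading_order)"
      using kth_step_at_bounds[OF kth] by (simp_all add: count_zeta_path)
    moreover have "length (filter ?P reading_order) \<le> 2 * n"
      using length_filter_le[of ?P reading_order] by (simp add: length_reading_order)
    moreover have "filter ?P reading_order ! (i - 1) = reading_order ! (i - 1)"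
      using i by (intro decreasing_by_filter_nth[OF decreasing_reading_order]) auto
    moreover have "m < 2 * n" using kth length_zeta_path[OF square] by (simp add: kth_step_at_def)
    moreover have "events ! m = (s, filter ?P reading_order ! (i - 1))"
      using kth_step_at_map_fst[of events s i m] kth unfolding map_fst_events event_labels_all by blast
    ultimately show ?thesis by simp
  qed
  show ?thesis
  proof
    assume R: "m < 2 * n \<and> 1 \<le> i \<and> i \<le> 2 * n \<and> events ! m = (s, reading_order ! (i - 1))"
    let ?i = "count_list (take (Suc m) (zeta_path n p)) s"
    have "kth_step_at (map fst events) s ?i m"
      using R unfolding kth_step_at_def by (simp add: map_fst_events[symmetric] length_events)
    then have kth: "kth_step_at (zeta_path n p) s ?i m" by (simp only: map_fst_events)
    then have "reading_order ! (?i - 1) = reading_order ! (i - 1)" "1 \<le> ?i" "?i \<le> 2 * n"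
      using fwd[OF kth] R by auto
    then have "?i - 1 = i - 1"
      using R by (subst (asm) nth_eq_iff_index_eq[OF distinct_reading_order]) (auto simp: length_reading_order)
    then have "?i = i" using \<open>1 \<le> ?i\<close> R by linarith
    with kth show "kth_step_at (zeta_path n p) s i m" by simp
  qed (rule fwd)
qed

text \<open>The East event of a row comes after its North event, so every prefix containing the
  former contains the latter.\<close>

lemma zeta_path_ballot: "zeta_path n p \<in> ballot_paths n"
proof -
  have "count_list (take m (zeta_path n p)) East \<le> count_list (take m (zeta_path n p)) North"
    if m: "m \<le> 2 * n" for m
  proof -
    \<comment> \<open>A proper prefix is cut off by the time of its next event, the whole list by
      time 0.\<close>
    have "\<exists>c. take m events = filter (\<lambda>e. c < time e) events"
    proof (cases "m < 2 * n")
      case True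
      then show ?thesis
        using decreasing_by_take[OF decreasing_events, of m] by (auto simp: length_events)
    next
      case False
      have "filter (\<lambda>e. 0 < time e) events = events" by (rule filter_True) (auto simp: set_events)
      with False m show ?thesis by (intro exI[of _ 0]) (simp add: length_events)
    qed
    then obtain c where "take m events = filter (\<lambda>e. c < time e) events" ..
    then have eq: "take m (zeta_path n p) = map fst (filter (\<lambda>e. c < time e) events)"
      by (metis map_fst_events take_map)
    show ?thesis unfolding eq count_filter_events by (rule length_filter_mono) auto
  qed
  then show ?thesis by (simp add: ballot_paths_def length_zeta_path[OF square])
qed

section \<open>Inversions as the common source of both statistics\<close>

definition inversions :: "(int \<Rightarrow> int) \<Rightarrow> (int \<times> int) set" where
  "inversions \<sigma> = {(k, l). k \<in> rows \<and> l \<in> rows \<and> key l < key k \<and> key k < key l + width \<and> \<sigma> l < \<sigma> k}"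

lemma finite_inversions: "finite (inversions \<sigma>)"
  by (rule finite_subset[of _ "rows \<times> rows"]) (auto simp: inversions_def finite_rows)

lemma key_gap_iff:
  assumes "k \<in> rows" "l \<in> rows"
  shows "key l < key k \<and> key k < key l + width \<longleftrightarrow>
    level k = level l \<and> l < k \<or> level k = level l + 1 \<and> k < l"
  unfolding key_less_iff[OF assms(2,1)] key_less_shift_iff[OF assms] by auto

text \<open>The East steps before the \<open>j\<close>-th North step, of row \<open>l\<close>,
  belong to the rows with key above \<open>key l + width\<close>, a prefix of
  \<open>reading_order\<close>. Its length is at most \<open>i - 1\<close> when the
  \<open>i\<close>-th row lies outside; \<open>key_neq_shift\<close> makes the resulting inequality
  strict.\<close>

lemma north_x_zeta_path_le_iff:
  assumes "1 \<le> i" "i \<le> 2 * n" "1 \<le> j" "j \<le> count_list (zeta_path n p) North" "j \<le> 2 * n"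
  shows "north_x (zeta_path n p) j \<le> i - 1 \<longleftrightarrow>
    key (reading_order ! (i - 1)) < key (reading_order ! (j - 1)) + width"
proof -
  let ?k = "reading_order ! (i - 1)" and ?l = "reading_order ! (j - 1)"
  obtain m where m: "kth_step_at (zeta_path n p) North j m" using kth_step_at_exists assms(3,4) by blast
  then have em: "m < 2 * n" "events ! m = (North, ?l)" using kth_step_iff by auto
  have tm: "time (events ! m) = key ?l" using em by (simp add: time_def)
  have "events ! m \<in> set events" using em(1) by (simp add: length_events)
  then have pos: "0 < key ?l" using tm em(2) by (auto simp: set_events)
  have "take m (zeta_path n p) = map fst (filter (\<lambda>e. key ?l < time e) events)"
    using decreasing_by_take[OF decreasing_events, of m] em(1) tm
    by (simp add: length_events map_fst_events[symmetric] take_map)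
  then have "north_x (zeta_path n p) j = length (filter (\<lambda>k. key ?l + width < key k) reading_order)"
    using kth_step_at_north_x[OF m] count_filter_events[of "key ?l" East] pos by simp
  moreover have "key ?l + width < key ?k \<longleftrightarrow> i - 1 < length (filter (\<lambda>k. key ?l + width < key k) reading_order)"
    using assms by (intro decreasing_by_threshold[OF decreasing_reading_order]) (simp add: length_reading_order)
  moreover have "?k \<in> rows" "?l \<in> rows" using assms by (auto intro: reading_order_in_rows)
  ultimately show ?thesis using key_neq_shift[of ?k ?l] by linarith
qed

lemma area'_eq_card_inversions:
  "area' n (zeta_path n p, map \<sigma> reading_order) =
    card {(k, l) \<in> inversions \<sigma>. 0 \<le> key k + key l - width}"
proof -
  let ?I = "{1..2 * n}" and ?g = "\<lambda>i. reading_order ! (i - 1)" and ?w = "map \<sigma> reading_order"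
  let ?X = "{(k, l) \<in> inversions \<sigma>. 0 \<le> key k + key l - width}"
  have bij: "bij_betw ?g ?I rows"
  proof (rule bij_betw_imageI)
    show "inj_on ?g ?I"
      using distinct_reading_order by (auto simp: inj_on_def nth_eq_iff_index_eq length_reading_order)
    have "?g ` ?I = (\<lambda>i. reading_order ! i) ` {..<2 * n}"
    proof -
      have "(\<lambda>i. i - 1) ` ?I = {..<2 * n}"
      proof -
        have "x \<in> (\<lambda>i. i - 1) ` ?I" if "x < 2 * n" for x
          using that by (intro image_eqI[of _ _ "Suc x"]) auto
        then show ?thesis by auto
      qed
      from arg_cong[OF this, of "(`) ((!) reading_order)"] show ?thesis by (simp only: image_image)
    qed
    then show "?g ` ?I = rows"
      using set_reading_order by (auto simp: set_conv_nth length_reading_order)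
  qed
  have "(1 \<le> i \<and> i < j \<and> i + j \<le> 2 * n + 1 \<and> j \<le> count_list (zeta_path n p) North \<and>
      north_x (zeta_path n p) j \<le> i - 1 \<and> letter ?w i > letter ?w j) \<longleftrightarrow>
      i \<in> ?I \<and> j \<in> ?I \<and> (?g i, ?g j) \<in> ?X" for i j
  proof (cases "i \<in> ?I \<and> j \<in> ?I")
    case True
    then have b: "1 \<le> i" "i \<le> 2 * n" "1 \<le> j" "j \<le> 2 * n" by auto
    have r: "?g i \<in> rows" "?g j \<in> rows" using b by (auto intro: reading_order_in_rows)
    note nth_less = decreasing_by_nth_less_iff[OF decreasing_reading_order, unfolded length_reading_order]
    have less: "i < j \<longleftrightarrow> key (?g j) < key (?g i)"
      using nth_less[of "i - 1" "j - 1"] b by auto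
    \<comment> \<open>By antisymmetry, letter \<open>2 * n + 1 - j\<close> belongs to the negative
      of row \<open>?g j\<close>. The bound on \<open>i + j\<close> says that \<open>?g i\<close> is
      read no later than that row, hence compares \<open>key (?g i)\<close> with
      \<open>width - key (?g j)\<close>.\<close>
    have "reading_order ! (2 * n - j) = - ?g j"
      using antisymmetric_list_nth[OF uminus_rev_reading_order, of "j - 1"] b
      by (simp add: length_reading_order)
    then have "key (reading_order ! (2 * n - j)) = width - key (?g j)" using key_minus[OF r(2)] by simp
    moreover have "2 * n - j < i - 1 \<longleftrightarrow> key (?g i) < key (reading_order ! (2 * n - j))"
      using nth_less[of "2 * n - j" "i - 1"] b by auto
    ultimately have sum: "i + j \<le> 2 * n + 1 \<longleftrightarrow> 0 \<le> key (?g i) + key (?g j) - width"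
      using b by linarith
    have "0 < key (?g j) \<longleftrightarrow> j - 1 < length (filter (\<lambda>k. 0 < key k) reading_order)"
      using b by (intro decreasing_by_threshold[OF decreasing_reading_order]) (simp add: length_reading_order)
    \<comment> \<open>Membership in \<open>?X\<close> entails this positivity: combine
      \<open>width - key l \<le> key k\<close> with \<open>key k < key l + width\<close>.\<close>
    then have cnt: "j \<le> count_list (zeta_path n p) North \<longleftrightarrow> 0 < key (?g j)"
      using b by (auto simp: count_zeta_path)
    have lab: "letter ?w i = \<sigma> (?g i)" "letter ?w j = \<sigma> (?g j)"
      using b by (simp_all add: letter_def length_reading_order)
    have "(?g i, ?g j) \<in> ?X \<longleftrightarrow> key (?g j) < key (?g i) \<and> key (?g i) < key (?g j) + width \<and>
        \<sigma> (?g j) < \<sigma> (?g i) \<and> 0 \<le> key (?g i) + key (?g j) - width"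
      using r by (auto simp: inversions_def)
    then show ?thesis
      using True b less sum cnt lab north_x_zeta_path_le_iff[OF b(1,2,3) _ b(4)] by auto
  qed auto
  then have "area' n (zeta_path n p, ?w) = card {(i, j). i \<in> ?I \<and> j \<in> ?I \<and> (?g i, ?g j) \<in> ?X}"
    unfolding area'_def by simp
  also have "\<dots> = card ?X"
    by (rule card_pairs_bij[OF bij]) (auto simp: inversions_def)
  finally show ?thesis .
qed

lemma dinv'_eq_card_inversions:
  assumes odd: "\<And>k. k \<in> rows \<Longrightarrow> \<sigma> (- k) = - \<sigma> k"
  shows "dinv' n (p, \<sigma>) = card {(k, l) \<in> inversions \<sigma>. 0 \<le> k + l}"
proof -
  let ?a = "area_entry p" and ?l = "\<lambda>i. \<sigma> (int i)"
  let ?S1 = "{(i, j). 1 \<le> i \<and> i < j \<and> j \<le> n \<and> ?a i = ?a j \<and> ?l i < ?l j}"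
  let ?S2 = "{(i, j). 1 \<le> i \<and> i < j \<and> j \<le> n \<and> ?a i = ?a j + 1 \<and> ?l i > ?l j}"
  let ?S3 = "{(i, j). 1 \<le> i \<and> i < j \<and> j \<le> n \<and> ?a i = - ?a j \<and> ?l i < - ?l j}"
  let ?S4 = "{(i, j). 1 \<le> i \<and> i < j \<and> j \<le> n \<and> ?a i = - ?a j + 1 \<and> ?l i > - ?l j}"
  let ?S5 = "{i. 1 \<le> i \<and> i \<le> n \<and> ?a i = 0 \<and> ?l i < 0}"
  let ?Y = "{(k, l) \<in> inversions \<sigma>. 0 \<le> k + l}"
  \<comment> \<open>The five terms of \<open>dinv'\<close> sort the inversions with
    \<open>0 \<le> k + l\<close> by signs and level difference: \<open>f1\<close> and
    \<open>f2\<close> have two positive rows, \<open>f3\<close> and \<open>f4\<close> one negative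
    row of smaller absolute value, and \<open>f5\<close> the case \<open>k + l = 0\<close>.\<close>
  define f1 f2 f3 f4 :: "nat \<times> nat \<Rightarrow> int \<times> int" and f5 :: "nat \<Rightarrow> int \<times> int" where
    "f1 = (\<lambda>(i, j). (int j, int i))" and "f2 = (\<lambda>(i, j). (int i, int j))" and
    "f3 = (\<lambda>(i, j). (- int i, int j))" and "f4 = (\<lambda>(i, j). (int j, - int i))" and
    "f5 = (\<lambda>i. (- int i, int i))"
  have inv: "(k, l) \<in> inversions \<sigma> \<longleftrightarrow> k \<in> rows \<and> l \<in> rows \<and> \<sigma> l < \<sigma> k \<and>
      (level k = level l \<and> l < k \<or> level k = level l + 1 \<and> k < l)" for k l
    using key_gap_iff[of k l] by (auto simp: inversions_def)
  have posr: "int i \<in> rows \<longleftrightarrow> 1 \<le> i \<and> i \<le> n" for i by (auto simp: rows_def)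
  have negl: "level (- int i) = 1 - ?a i" "\<sigma> (- int i) = - ?l i" if "1 \<le> i" "i \<le> n" for i
    using that level_minus[of "int i"] odd[of "int i"] by (simp_all add: posr level_int)
  have sub: "f1 ` ?S1 \<subseteq> ?Y" "f2 ` ?S2 \<subseteq> ?Y" "f3 ` ?S3 \<subseteq> ?Y" "f4 ` ?S4 \<subseteq> ?Y" "f5 ` ?S5 \<subseteq> ?Y"
    by (auto simp: f1_def f2_def f3_def f4_def f5_def inv posr minus_rows negl level_int)
  have sup: "(k, l) \<in> f1 ` ?S1 \<union> f2 ` ?S2 \<union> f3 ` ?S3 \<union> f4 ` ?S4 \<union> f5 ` ?S5" if kl: "(k, l) \<in> ?Y" for k l
  proof -
    from kl have k: "k \<in> rows" and l: "l \<in> rows" and i: "(k, l) \<in> inversions \<sigma>" and s: "0 \<le> k + l" by (auto simp: inv)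
    from k show ?thesis
    proof (cases rule: rows_cases)
      case (1 x)
      note x = this
      from l show ?thesis
      proof (cases rule: rows_cases)
        case (1 y)
        with i x have "y < x \<and> (y, x) \<in> ?S1 \<or> (x, y) \<in> ?S2" by (auto simp: inv level_int)
        then have "(k, l) = f1 (y, x) \<and> (y, x) \<in> ?S1 \<or> (k, l) = f2 (x, y) \<and> (x, y) \<in> ?S2"
          using 1 x by (auto simp: f1_def f2_def)
        then show ?thesis by blast
      next
        case (2 y)
        \<comment> \<open>The levels of a row and its negative sum to 1, so by parity they
          differ.\<close>
        have "level k \<noteq> level l" if "x = y" using x 2 that negl[of y] by (simp add: level_int) presburger
        then have "x \<noteq> y" using i x 2 by (auto simp: inv)
        with i s x 2 have "(y, x) \<in> ?S4" by (auto simp: inv level_int negl)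
        moreover have "(k, l) = f4 (y, x)" using x 2 by (simp add: f4_def)
        ultimately show ?thesis by blast
      qed
    next
      case (2 x)
      note x = this
      from l show ?thesis
      proof (cases rule: rows_cases)
        case (1 y)
        show ?thesis
        proof (cases "x = y")
          case True
          with i s x 1 have "x \<in> ?S5" by (auto simp: inv level_int negl)
          moreover have "(k, l) = f5 x" using x 1 True by (simp add: f5_def)
          ultimately show ?thesis by blast
        next
          case False
          with i s x 1 have "(x, y) \<in> ?S3" by (auto simp: inv level_int negl)
          moreover have "(k, l) = f3 (x, y)" using x 1 by (simp add: f3_def)
          ultimately show ?thesis by blast
        qed
      next
        case (2 y)
        with s x show ?thesis by auto
      qed
    qed
  qed
  have Y: "?Y = f1 ` ?S1 \<union> f2 ` ?S2 \<union> f3 ` ?S3 \<union> f4 ` ?S4 \<union> f5 ` ?S5"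
  proof (rule equalityI[OF subrelI[OF sup]])
    show "f1 ` ?S1 \<union> f2 ` ?S2 \<union> f3 ` ?S3 \<union> f4 ` ?S4 \<union> f5 ` ?S5 \<subseteq> ?Y"
      by (intro Un_least sub)
  qed
  have finY: "finite ?Y" by (rule finite_subset[OF _ finite_inversions[of \<sigma>]]) auto
  have fin: "finite (f1 ` ?S1)" "finite (f2 ` ?S2)" "finite (f3 ` ?S3)" "finite (f4 ` ?S4)" "finite (f5 ` ?S5)"
    by (intro finite_subset[OF sub(1) finY] finite_subset[OF sub(2) finY] finite_subset[OF sub(3) finY]
        finite_subset[OF sub(4) finY] finite_subset[OF sub(5) finY])+
  have "card ?Y = card (f1 ` ?S1) + card (f2 ` ?S2) + card (f3 ` ?S3) + card (f4 ` ?S4) + card (f5 ` ?S5)"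
  proof -
    have "f1 ` ?S1 \<inter> f2 ` ?S2 = {}" "(f1 ` ?S1 \<union> f2 ` ?S2) \<inter> f3 ` ?S3 = {}"
      "(f1 ` ?S1 \<union> f2 ` ?S2 \<union> f3 ` ?S3) \<inter> f4 ` ?S4 = {}"
      "(f1 ` ?S1 \<union> f2 ` ?S2 \<union> f3 ` ?S3 \<union> f4 ` ?S4) \<inter> f5 ` ?S5 = {}"
      unfolding f1_def f2_def f3_def f4_def f5_def by auto
    then show ?thesis unfolding Y using fin by (simp only: card_Un_disjoint finite_Un simp_thms)
  qed
  moreover have "inj_on f1 S" "inj_on f2 S" "inj_on f3 S" "inj_on f4 S" "inj_on f5 T" for S T
    by (auto simp: inj_on_def f1_def f2_def f3_def f4_def f5_def)
  ultimately show ?thesis by (simp add: dinv'_def card_image Let_def)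
qed

text \<open>The involution \<open>(k, l) \<mapsto> (- l, - k)\<close> preserves inversions and
  negates both \<open>k + l\<close> and \<open>key k + key l - width\<close>, whose signs select the
  representatives counted by the two statistics.\<close>

lemma dinv'_eq_area':
  assumes odd: "\<And>k. k \<in> rows \<Longrightarrow> \<sigma> (- k) = - \<sigma> k"
  shows "dinv' n (p, \<sigma>) = area' n (zeta_path n p, map \<sigma> reading_order)"
proof -
  have "card {x \<in> inversions \<sigma>. 0 \<le> (case x of (k, l) \<Rightarrow> k + l)} =
      card {x \<in> inversions \<sigma>. 0 \<le> (case x of (k, l) \<Rightarrow> key k + key l - width)}"
  proof (rule card_halves_eq[where h = "\<lambda>(k, l). (- l, - k)", OF finite_inversions])
    fix x assume "x \<in> inversions \<sigma>"
    then obtain k l where x: "x = (k, l)" and kl: "(k, l) \<in> inversions \<sigma>" and "k \<in> rows" "l \<in> rows"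
      by (auto simp: inversions_def)
    then show "(case x of (k, l) \<Rightarrow> (- l, - k)) \<in> inversions \<sigma>"
      by (simp add: inversions_def minus_rows key_minus odd)
    show "(case case x of (k, l) \<Rightarrow> (- l, - k) of (k, l) \<Rightarrow> key k + key l - width) =
        - (case x of (k, l) \<Rightarrow> key k + key l - width)"
      using x \<open>k \<in> rows\<close> \<open>l \<in> rows\<close> by (simp add: key_minus)
    \<comment> \<open>Both quantities vanish exactly at the fixed pairs of the involution, where the
      two selections therefore agree.\<close>
    have "k + l = 0 \<longleftrightarrow> k = - l" by auto
    also have "\<dots> \<longleftrightarrow> key k = key (- l)" using \<open>k \<in> rows\<close> \<open>l \<in> rows\<close> by (simp add: key_eq_iff minus_rows)
    finally show "(case x of (k, l) \<Rightarrow> k + l) = 0 \<longleftrightarrow> (case x of (k, l) \<Rightarrow> key k + key l - width) = 0"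
      using x \<open>l \<in> rows\<close> by (auto simp: key_minus)
  qed (auto split: prod.splits)
  moreover have "{x \<in> inversions \<sigma>. 0 \<le> (case x of (k, l) \<Rightarrow> f k l)} = {(k, l) \<in> inversions \<sigma>. 0 \<le> f k l}"
    for f :: "int \<Rightarrow> int \<Rightarrow> int" by auto
  ultimately show ?thesis
    by (simp add: dinv'_eq_card_inversions[where \<sigma> = \<sigma>, OF odd] area'_eq_card_inversions)
qed

end

section \<open>The labelling conditions\<close>

lemma signed_perms_comp:
  assumes "\<sigma> \<in> signed_perms n" "\<rho> \<in> signed_perms n"
  shows "\<sigma> \<circ> \<rho> \<in> signed_perms n"
proof -
  let ?R = "{k. 1 \<le> \<bar>k\<bar> \<and> \<bar>k\<bar> \<le> int n}"
  have \<sigma>: "\<sigma> permutes ?R" "\<And>k. k \<in> ?R \<Longrightarrow> \<sigma> (- k) = - \<sigma> k"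
    and \<rho>: "\<rho> permutes ?R" "\<And>k. k \<in> ?R \<Longrightarrow> \<rho> (- k) = - \<rho> k"
    using assms by (auto simp: signed_perms_def)
  have "(\<sigma> \<circ> \<rho>) (- k) = - (\<sigma> \<circ> \<rho>) k" if k: "k \<in> ?R" for k
  proof -
    have "\<rho> k \<in> ?R" using permutes_in_image[OF \<rho>(1)] k by blast
    then show ?thesis using \<sigma>(2) \<rho>(2)[OF k] by simp
  qed
  then show ?thesis using permutes_compose[OF \<rho>(1) \<sigma>(1)] unfolding signed_perms_def by blast
qed

lemma signed_perms_inv:
  assumes "\<rho> \<in> signed_perms n"
  shows "inv \<rho> \<in> signed_perms n"
proof -
  let ?R = "{k. 1 \<le> \<bar>k\<bar> \<and> \<bar>k\<bar> \<le> int n}"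
  have perm: "\<rho> permutes ?R" and odd: "\<And>k. k \<in> ?R \<Longrightarrow> \<rho> (- k) = - \<rho> k"
    using assms by (auto simp: signed_perms_def)
  have "inv \<rho> (- k) = - inv \<rho> k" if k: "k \<in> ?R" for k
  proof -
    have "inv \<rho> k \<in> ?R" using permutes_in_image[OF permutes_inv[OF perm]] k by blast
    then have "\<rho> (- inv \<rho> k) = - k" using odd permutes_inverses(1)[OF perm, of k] by simp
    then show ?thesis using permutes_inverses(2)[OF perm] by metis
  qed
  then show ?thesis using permutes_inv[OF perm] by (auto simp: signed_perms_def)
qed

context square_path
begin

lemma signed_permsD:
  assumes "\<sigma> \<in> signed_perms n"
  shows "\<sigma> permutes rows" "k \<in> rows \<Longrightarrow> \<sigma> (- k) = - \<sigma> k"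
  using assms by (auto simp: signed_perms_def rows_def)

text \<open>Oddness of \<open>\<sigma>\<close> turns the appended negatives into labels of negative
  rows; a row with area entry \<open>- i + 1\<close> has its negative on level
  \<open>i\<close>.\<close>

lemma zeta_word_eq:
  assumes "\<sigma> \<in> signed_perms n"
  shows "zeta_word n p \<sigma> = map \<sigma> reading_order"
proof -
  have odd: "\<sigma> (- k) = - \<sigma> k" if "k \<in> rows" for k by (rule signed_permsD(2)[OF assms that])
  have block: "map \<sigma> (filter (\<lambda>k. level k = i) rows_desc) =
      map (\<lambda>k. \<sigma> (int k)) (filter (\<lambda>k. area_entry p k = i) (rev [1..<Suc n])) @
      map (\<lambda>k. - \<sigma> (int k)) (filter (\<lambda>k. area_entry p k = - i + 1) [1..<Suc n])" for i
  proof -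
    have "map \<sigma> (filter (\<lambda>k. level k = i) (map int ks)) =
        map (\<lambda>k. \<sigma> (int k)) (filter (\<lambda>k. area_entry p k = i) ks)" if "set ks \<subseteq> {1..n}" for ks
      using that by (induction ks) (auto simp: level_int)
    moreover have "map \<sigma> (filter (\<lambda>k. level k = i) (map uminus (map int ks))) =
        map (\<lambda>k. - \<sigma> (int k)) (filter (\<lambda>k. area_entry p k = - i + 1) ks)" if "set ks \<subseteq> {1..n}" for ks
      using that
    proof (induction ks)
      case (Cons j ks)
      then have j: "int j \<in> rows" "1 \<le> j" by (auto simp: rows_def)
      have "level (- int j) = i \<longleftrightarrow> area_entry p j = - i + 1"
        using level_minus[OF j(1)] level_int[OF j(2)] by auto
      with Cons odd[OF j(1)] show ?case by simp
    qed simp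
    moreover have "set (rev [1..<Suc n]) \<subseteq> {1..n}" "set [1..<Suc n] \<subseteq> {1..n}" by auto
    ultimately show ?thesis
      unfolding rows_desc_def row_list_def rev_map filter_append map_append by (simp only:)
  qed
  have half: "zeta_half_word n p \<sigma> = map \<sigma> half_order"
    unfolding zeta_half_word_def half_order_def map_concat map_map comp_def block ..
  have "map \<sigma> (map uminus (rev half_order)) = map uminus (rev (map \<sigma> half_order))"
    using odd by (simp add: rev_map comp_def set_half_order)
  then show ?thesis by (simp add: zeta_word_def half reading_order_def Let_def)
qed

lemma signed_word_eq: "signed_word n \<tau> = map \<tau> rows_desc"
proof (rule nth_equalityI)
  show "length (signed_word n \<tau>) = length (map \<tau> rows_desc)"
    by (simp add: signed_word_def length_rows_desc del: upt_Suc)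
  fix i assume "i < length (signed_word n \<tau>)"
  then have i: "i < 2 * n" by (simp add: signed_word_def del: upt_Suc)
  have len: "length row_list = n" by (simp add: row_list_def del: upt_Suc)
  have nth: "row_list ! j = int j + 1" if "j < n" for j
    using that by (simp add: row_list_def del: upt_Suc)
  have "rows_desc ! i = (if Suc i \<le> n then int n - int i else int n - int (Suc i))"
    using i by (auto simp: rows_desc_def nth_append len rev_nth nth of_nat_diff)
  then show "signed_word n \<tau> ! i = map \<tau> rows_desc ! i"
    using i by (simp add: signed_word_def length_rows_desc del: upt_Suc)
qed

text \<open>\<open>signed_word\<close> reads along \<open>rows_desc\<close> and
  \<open>zeta_word\<close> along \<open>reading_order\<close>. Both lists enumerate the rows and are
  fixed by reversing and negating, so matching positions gives a signed permutation that translates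
  between them.\<close>

lemma reading_order_signed_perm:
  obtains \<rho> where "\<rho> \<in> signed_perms n" "map \<rho> rows_desc = reading_order"
proof -
  define \<rho> where "\<rho> k = (case map_of (zip rows_desc reading_order) k of None \<Rightarrow> k | Some l \<Rightarrow> l)" for k
  have dist: "distinct rows_desc" using sorted_rows_desc by (intro decreasing_by_distinct[of "\<lambda>k. k"])
  have nth: "\<rho> (rows_desc ! i) = reading_order ! i" if "i < 2 * n" for i
    using that dist by (simp add: \<rho>_def map_of_zip_nth length_rows_desc length_reading_order)
  have map: "map \<rho> rows_desc = reading_order"
    by (rule nth_equalityI) (simp_all add: nth length_rows_desc length_reading_order)
  have img: "\<rho> ` rows = rows" using arg_cong[OF map, of set] by (simp add: set_rows_desc set_reading_order)
  have "\<rho> permutes rows"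
  proof (rule bij_imp_permutes)
    show "bij_betw \<rho> rows rows"
      using img finite_rows by (simp add: bij_betw_def eq_card_imp_inj_on)
    show "\<rho> k = k" if "k \<notin> rows" for k
    proof -
      have "map_of (zip rows_desc reading_order) k = None"
        using that by (simp add: map_of_zip_is_None length_rows_desc length_reading_order set_rows_desc)
      then show ?thesis by (simp add: \<rho>_def)
    qed
  qed
  moreover have "\<rho> (- k) = - \<rho> k" if k: "k \<in> rows" for k
  proof -
    obtain i where i: "i < 2 * n" "k = rows_desc ! i"
      using k by (metis in_set_conv_nth length_rows_desc set_rows_desc)
    then have "- k = rows_desc ! (2 * n - 1 - i)"
      using antisymmetric_list_nth[OF uminus_rev_rows_desc, of i] by (simp add: length_rows_desc)
    moreover have "reading_order ! (2 * n - 1 - i) = - reading_order ! i"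
      using antisymmetric_list_nth[OF uminus_rev_reading_order, of i] i by (simp add: length_reading_order)
    moreover have "2 * n - 1 - i < 2 * n" using i by linarith
    ultimately show ?thesis using nth[of i] nth[of "2 * n - 1 - i"] i by metis
  qed
  ultimately have "\<rho> \<in> signed_perms n" by (auto simp: signed_perms_def rows_def)
  with map show thesis using that by blast
qed

section \<open>Rises among the signed rows and valleys of the zeta path\<close>

definition prev :: "int \<Rightarrow> int" where
  "prev k = (if k = 1 then -1 else k - 1)"

text \<open>There is no row 0, so \<open>prev\<close> steps from 1 to -1; the lowest row
  \<open>- int n\<close> has no predecessor.\<close>

lemma prev_rows:
  assumes "k \<in> rows" "k \<noteq> - int n"
  shows "prev k \<in> rows" "prev k < k" "x \<in> rows \<Longrightarrow> x < k \<Longrightarrow> x \<le> prev k"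
  using assms n_pos by (auto simp: prev_def rows_def)

text \<open>Slow growth of the area vector, its reflection on the negative rows, and
  \<open>area_entry_1_le\<close> at the passage from row -1 to row 1.\<close>

lemma level_le_prev:
  assumes "k \<in> rows" "k \<noteq> - int n"
  shows "level k \<le> level (prev k) + 1"
  using assms(1)
proof (cases rule: rows_cases)
  case (1 i)
  show ?thesis
  proof (cases "i = 1")
    case True
    have "level (- 1) = 1 - level 1" using level_minus[of 1] n_pos by (simp add: rows_def)
    then show ?thesis using area_entry_1_le 1 True level_int[of 1] by (simp add: prev_def)
  next
    case False
    then have "prev k = int (i - 1)" "1 \<le> i - 1" "i - 1 < n" using 1 by (auto simp: prev_def of_nat_diff)
    then show ?thesis using area_step_le[of "i - 1"] 1 level_int[of "i - 1"] level_int[of i] by simp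
  qed
next
  case (2 i)
  then have i: "i < n" "prev k = - int (Suc i)" using assms(2) by (auto simp: prev_def)
  then have "level (prev k) = 1 - area_entry p (Suc i)" "level k = 1 - area_entry p i"
    using level_minus[of "int (Suc i)"] level_minus[of "int i"] level_int[of "Suc i"] level_int[of i] 2
    by (auto simp: rows_def)
  then show ?thesis using area_step_le[of i] 2 i by simp
qed

lemma level_first: "level (- int n) \<le> 1"
  using level_minus[of "int n"] level_int[of n] area_entry_bounds(1)[of n] n_pos by (simp add: rows_def)

lemma level_1: "level 1 \<le> 1" "level (- 1) = 1 - level 1"
  using area_entry_1_le level_int[of 1] level_minus[of 1] n_pos by (auto simp: rows_def)

lemma time_simps: "time (North, k) = key k" "time (East, k) = key k - width"
  by (simp_all add: time_def)

text \<open>If row \<open>k\<close> is not the top of a rise, then the last row before it that is not above its level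
  lies on the same level, and the East step of that row separates the East step of \<open>k\<close> from
  every later North step.\<close>

lemma east_event_cases:
  assumes k: "k \<in> rows" and t: "width < key k"
  shows "k \<noteq> - int n"
    and "level k = level (prev k) + 1 \<or>
      (\<exists>k' \<in> rows. k' < k \<and> level k' = level k \<and> width < key k' \<and>
        (\<forall>x \<in> rows. k' < x \<and> x < k \<longrightarrow> level k < level x))"
proof -
  have lk: "1 < level k \<or> level k = 1 \<and> 0 < k" using t width_less_key_iff[OF k] by simp
  show kn: "k \<noteq> - int n" using lk level_first n_pos by auto
  show "level k = level (prev k) + 1 \<or>
      (\<exists>k' \<in> rows. k' < k \<and> level k' = level k \<and> width < key k' \<and>
        (\<forall>x \<in> rows. k' < x \<and> x < k \<longrightarrow> level k < level x))"
  proof (rule disjCI)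
    assume no: "\<not> (\<exists>k' \<in> rows. k' < k \<and> level k' = level k \<and> width < key k' \<and>
        (\<forall>x \<in> rows. k' < x \<and> x < k \<longrightarrow> level k < level x))"
    show "level k = level (prev k) + 1"
    proof (rule ccontr)
      assume "level k \<noteq> level (prev k) + 1"
      then have prev: "level k \<le> level (prev k)" using level_le_prev[OF k kn] by simp
      let ?C = "{x \<in> rows. x < k \<and> level x \<le> level k}"
      \<comment> \<open>The maximum below exists because the lowest row has level at most 1, while
        an East event of positive time requires \<open>1 \<le> level k\<close>.\<close>
      have "- int n \<in> ?C" using k kn level_first lk n_pos by (auto simp: rows_def)
      moreover have "finite ?C" using finite_rows by simp
      ultimately have Max: "Max ?C \<in> ?C" "\<And>x. x \<in> ?C \<Longrightarrow> x \<le> Max ?C" using Max_in by auto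
      define k' where "k' = Max ?C"
      have k': "k' \<in> rows" "k' < k" "level k' \<le> level k" using Max(1) by (auto simp: k'_def)
      have above: "level k < level x" if "x \<in> rows" "k' < x" "x < k" for x
        using Max(2)[of x] that by (force simp: k'_def)
      have eq: "level k' = level k"
      proof (rule ccontr)
        assume "level k' \<noteq> level k"
        then have less: "level k' < level k" using k' by simp
        \<comment> \<open>The row after \<open>k'\<close>. By slow growth its level is at most
          \<open>level k\<close>, so it is not strictly between \<open>k'\<close> and
          \<open>k\<close> and must be \<open>k\<close> itself, against \<open>prev\<close>.\<close>
        define x where "x = (if k' = -1 then 1 else k' + 1)"
        have x: "x \<in> rows" "prev x = k'" "x \<noteq> - int n" "k' < x" "x \<le> k"
          using k' k by (auto simp: x_def prev_def rows_def)
        then have "level x \<le> level k" using level_le_prev[of x] less by simp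
        then have "x = k" using above[of x] x by force
        then show False using x less prev by simp
      qed
      moreover have "width < key k'"
      proof (rule ccontr)
        assume "\<not> width < key k'"
        \<comment> \<open>Otherwise \<open>k'\<close> and \<open>k\<close> straddle 0 on level 1.
          Row 1 then lies strictly between them and would need level above 1.\<close>
        then have one: "level k = 1" "0 < k" "k' < 0"
          using width_less_key_iff[OF k'(1)] lk eq k'(1) by (auto simp: rows_def)
        then have "k \<noteq> 1" using prev level_1 by (auto simp: prev_def)
        then have "level k < level 1" using above[of 1] one n_pos by (auto simp: rows_def)
        then show False using level_1 one by simp
      qed
      ultimately show False using no k' above by blast
    qed
  qed
qed

text \<open>The exceptional rise from row -1 to row 1: the East event of the upper row is drawn
  while the North event of the lower row is not. It accounts for a final East step.\<close>

lemma rise_base_key_nonpos: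
  assumes "k \<in> rows" "width < key k" "level k = level (prev k) + 1" "\<not> 0 < key (prev k)"
  shows "k = 1 \<and> level k = 1"
proof -
  have "1 < level k \<or> level k = 1 \<and> 0 < k" using width_less_key_iff assms(1,2) by simp
  moreover have "\<not> (0 < level (prev k) \<or> level (prev k) = 0 \<and> 0 < prev k)"
    using key_pos_iff[of "prev k"] prev_rows(1)[OF assms(1) east_event_cases(1)[OF assms(1,2)]] assms(4) by simp
  ultimately show ?thesis using assms(3) by (auto simp: prev_def split: if_splits)
qed

text \<open>No event separates the East event of \<open>k\<close> from the North event of
  \<open>l\<close>. Both alternatives of \<open>east_event_cases\<close> supply an event after that
  of \<open>k\<close> which \<open>l\<close> may not pass; comparing keys leaves only
  \<open>l = prev k\<close>.\<close>

lemma valley_rise: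
  assumes m: "Suc m < 2 * n" "events ! m = (East, k)" "events ! Suc m = (North, l)"
  shows "k \<in> rows" "k \<noteq> - int n" "l = prev k" "level k = level l + 1"
proof -
  have "(East, k) \<in> set events" "(North, l) \<in> set events"
    using m nth_mem[of m events] nth_mem[of "Suc m" events] by (auto simp: length_events)
  then have k: "k \<in> rows" "width < key k" and l: "l \<in> rows" "0 < key l"
    by (auto simp: set_events time_simps)
  show "k \<in> rows" by fact
  show kn: "k \<noteq> - int n" using east_event_cases(1)[OF k] .
  note prev = prev_rows[OF k(1) kn]
  have kl: "key l + width < key k"
    using decreasing_by_nth_less_iff[OF decreasing_events, of m "Suc m"] m by (simp add: length_events time_simps)
  then have kl': "level l + 1 < level k \<or> level k = level l + 1 \<and> l < k"
    using shift_key_less_iff k l by simp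
  have next_event: "time e \<le> key l" if "e \<in> set events" "time e < key k - width" for e
    using decreasing_by_adjacent[OF decreasing_events, of m e] m that by (simp add: length_events time_simps)
  have "l = prev k \<and> level k = level (prev k) + 1"
    using east_event_cases(2)[OF k]
  proof
    assume rise: "level k = level (prev k) + 1"
    show ?thesis
    proof (cases "0 < key (prev k)")
      case True
      have "key (prev k) + width < key k" using rise prev k by (simp add: shift_key_less_iff)
      then have "key (prev k) \<le> key l"
        using next_event[of "(North, prev k)"] True prev by (simp add: set_events time_simps)
      then have "\<not> key l < key (prev k)" by simp
      then have "level l = level (prev k) \<and> prev k \<le> l" "l < k"
        using kl' rise unfolding key_less_iff[OF l(1) prev(1)] by auto
      then have "l = prev k" using prev(3)[of l] l by simp
      then show ?thesis using rise by simp
    next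
      case False
      then have "k = 1" "level k = 1" using rise_base_key_nonpos[OF k rise] by auto
      then have "l < 0 \<or> level l < 0" "level l \<le> 0" using kl' l by (auto simp: rows_def)
      then show ?thesis using l key_pos_iff[OF l(1)] by auto
    qed
  next
    assume "\<exists>k' \<in> rows. k' < k \<and> level k' = level k \<and> width < key k' \<and>
        (\<forall>x \<in> rows. k' < x \<and> x < k \<longrightarrow> level k < level x)"
    then obtain k' where k': "k' \<in> rows" "k' < k" "level k' = level k" "width < key k'"
      and above: "\<forall>x \<in> rows. k' < x \<and> x < k \<longrightarrow> level k < level x" by blast
    have "key k' < key k" using k' k by (simp add: key_less_iff)
    then have "key k' - width \<le> key l"
      using next_event[of "(East, k')"] k' by (simp add: set_events time_simps)
    then have "key k' < key l + width" using key_neq_shift[OF k'(1) l(1)] by simp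
    \<comment> \<open>So \<open>l\<close> would lie strictly between \<open>k'\<close> and
      \<open>k\<close> on a lower level, although all rows there lie above
      \<open>level k\<close>.\<close>
    then have "level k = level l + 1" "k' < l" "l < k"
      using key_less_shift_iff[OF k'(1) l(1)] k' kl' by auto
    then show ?thesis using above l by force
  qed
  then show "l = prev k" "level k = level l + 1" by auto
qed

text \<open>The East event of row 1 on level 1 has time 1, the least possible. Any other drawn East
  event is followed by another event, by \<open>east_event_cases\<close>.\<close>

lemma last_east_event:
  "events ! (2 * n - 1) = (East, k) \<longleftrightarrow> k = 1 \<and> level 1 = 1"
proof -
  have ne: "events \<noteq> []" using length_events n_pos by auto
  note last = decreasing_by_last[OF decreasing_events _ ne, unfolded length_events]
  show ?thesis
  proof
    assume e: "events ! (2 * n - 1) = (East, k)"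
    then have mem: "(East, k) \<in> set events"
      using nth_mem[of "2 * n - 1" events] n_pos by (simp add: length_events)
    then have k: "k \<in> rows" "width < key k" by (auto simp: set_events time_simps)
    have min: "key k - width \<le> time e" if "e \<in> set events" for e
      using last[OF mem] e that by (auto simp: time_simps)
    note prev = prev_rows[OF k(1) east_event_cases(1)[OF k]]
    show "k = 1 \<and> level 1 = 1"
      using east_event_cases(2)[OF k]
    proof
      assume rise: "level k = level (prev k) + 1"
      have "key (prev k) + width < key k" using rise prev k by (simp add: shift_key_less_iff)
      then have "\<not> 0 < key (prev k)"
        using min[of "(North, prev k)"] prev by (auto simp: set_events time_simps)
      then show ?thesis using rise_base_key_nonpos[OF k rise] by auto
    next
      assume "\<exists>k' \<in> rows. k' < k \<and> level k' = level k \<and> width < key k' \<and>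
          (\<forall>x \<in> rows. k' < x \<and> x < k \<longrightarrow> level k < level x)"
      then obtain k' where k': "k' \<in> rows" "k' < k" "level k' = level k" "width < key k'" by blast
      then have "key k' < key k" using k by (simp add: key_less_iff)
      then show ?thesis using min[of "(East, k')"] k' by (simp add: set_events time_simps)
    qed
  next
    assume k: "k = 1 \<and> level 1 = 1"
    then have "time (East, k) = 1" by (simp add: time_simps key_def)
    moreover have "k \<in> rows" using k n_pos by (simp add: rows_def)
    ultimately show "events ! (2 * n - 1) = (East, k)"
      using last[of "(East, k)"] by (auto simp: set_events)
  qed
qed

text \<open>Both events have the same time level, so an event between them would belong to a row
  strictly between \<open>prev k\<close> and \<open>k\<close>.\<close>

lemma rise_valley:
  assumes k: "k \<in> rows" "k \<noteq> - int n" and rise: "level k = level (prev k) + 1" and pos: "0 < key (prev k)"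
  obtains m where "Suc m < 2 * n" "events ! m = (East, k)" "events ! Suc m = (North, prev k)"
proof -
  note prev = prev_rows[OF k]
  have less: "key (prev k) + width < key k" using rise prev k by (simp add: shift_key_less_iff)
  show thesis
  proof (rule decreasing_by_adjacentI[OF decreasing_events, of "(East, k)" "(North, prev k)"])
    show "(East, k) \<in> set events" "(North, prev k) \<in> set events" "time (North, prev k) < time (East, k)"
      using k prev pos less by (auto simp: set_events time_simps)
    fix e assume e: "e \<in> set events" "time (North, prev k) < time e" "time e < time (East, k)"
    obtain s x where sx: "e = (s, x)" "x \<in> rows" using e(1) by (auto simp: set_events)
    have "prev k < x \<and> x < k"
    proof (cases s)
      case North
      then have "key (prev k) < key x" "key x + width < key k" using e sx by (auto simp: time_simps)
      then show ?thesis using rise prev(1) k(1) sx(2) by (auto simp: key_less_iff shift_key_less_iff)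
    next
      case East
      then have "key (prev k) + width < key x" "key x < key k" using e sx by (auto simp: time_simps)
      then show ?thesis using rise prev(1) k(1) sx(2) by (auto simp: key_less_iff shift_key_less_iff)
    qed
    then show False using prev(3)[of x] sx by simp
  qed (use that length_events in auto)
qed

lemma is_valley_iff:
  "is_valley (zeta_path n p) i j \<longleftrightarrow> i \<in> {1..2 * n} \<and> j \<in> {1..2 * n} \<and>
    (\<exists>m. Suc m < 2 * n \<and> events ! m = (East, reading_order ! (i - 1)) \<and>
      events ! Suc m = (North, reading_order ! (j - 1)))"
  unfolding is_valley_def kth_step_iff by auto (meson Suc_lessD)

lemma reading_order_index:
  assumes "k \<in> rows"
  obtains i where "i \<in> {1..2 * n}" "reading_order ! (i - 1) = k"
proof -
  obtain i where "i < 2 * n" "reading_order ! i = k"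
    using assms by (metis in_set_conv_nth length_reading_order set_reading_order)
  then show thesis using that[of "Suc i"] by simp
qed

text \<open>A rise \<open>i\<close> of \<open>p\<close> appears twice among the signed rows, from
  \<open>i\<close> to \<open>i + 1\<close> and from \<open>-(i + 1)\<close> to \<open>-i\<close>;
  oddness of \<open>\<sigma>\<close> makes the two label inequalities equivalent. The condition on a
  first North step matches that on a final East step, both concerning row 1 on level 1.\<close>

lemma labelling_conditions_iff:
  assumes \<sigma>: "\<sigma> \<in> signed_perms n"
  defines "w \<equiv> map \<sigma> reading_order"
  shows "(\<forall>i j. is_valley (zeta_path n p) i j \<longrightarrow> letter w i > letter w j) \<and>
      (\<forall>i. kth_step_at (zeta_path n p) East i (length (zeta_path n p) - 1) \<longrightarrow> letter w i > 0) \<longleftrightarrow>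
    (\<forall>i. is_rise p i \<longrightarrow> \<sigma> (int i) < \<sigma> (int i + 1)) \<and> (p \<noteq> [] \<and> hd p = North \<longrightarrow> \<sigma> 1 > 0)"
    (is "?V \<and> ?L \<longleftrightarrow> ?R \<and> ?H")
proof
  have odd: "\<sigma> (- k) = - \<sigma> k" if "k \<in> rows" for k by (rule signed_permsD(2)[OF \<sigma> that])
  have letter: "letter w i = \<sigma> (reading_order ! (i - 1))" if "i \<in> {1..2 * n}" for i
    using that by (auto simp: w_def letter_def length_reading_order)
  have last: "kth_step_at (zeta_path n p) East i (length (zeta_path n p) - 1) \<longleftrightarrow>
      i \<in> {1..2 * n} \<and> reading_order ! (i - 1) = 1 \<and> level 1 = 1" for i
    unfolding kth_step_iff using last_east_event n_pos by (auto simp: length_zeta_path[OF square])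
  have p: "p \<noteq> []" using length_path n_pos by auto
  have hd: "hd p = North \<longleftrightarrow> level 1 = 1" using hd_North_iff level_int[of 1] by simp
  have one: "1 \<in> rows" using n_pos by (simp add: rows_def)
  have lev: "level (int i) = area_entry p i" "level (- int i) = 1 - area_entry p i" "\<sigma> (- int i) = - \<sigma> (int i)"
    if "1 \<le> i" "i \<le> n" for i
    using that level_minus[of "int i"] odd[of "int i"] by (auto simp: level_int rows_def)
  {
    assume "?V \<and> ?L"
    then have V: ?V and L: ?L by blast+
    have valley: "\<sigma> (prev k) < \<sigma> k"
      if k: "k \<in> rows" "k \<noteq> - int n" "level k = level (prev k) + 1" "0 < key (prev k)" for k
    proof -
      obtain m where m: "Suc m < 2 * n" "events ! m = (East, k)" "events ! Suc m = (North, prev k)"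
        using rise_valley[OF k] .
      obtain i where i: "i \<in> {1..2 * n}" "reading_order ! (i - 1) = k" using reading_order_index[OF k(1)] .
      obtain j where j: "j \<in> {1..2 * n}" "reading_order ! (j - 1) = prev k"
        using reading_order_index[OF prev_rows(1)[OF k(1,2)]] .
      have "is_valley (zeta_path n p) i j" unfolding is_valley_iff using i j m by auto
      then show ?thesis using V letter i j by fastforce
    qed
    have ?R
    proof (intro allI impI)
      fix i assume "is_rise p i"
      then have i: "1 \<le> i" "i < n" "area_entry p (Suc i) = area_entry p i + 1" by (auto simp: is_rise_iff)
      show "\<sigma> (int i) < \<sigma> (int i + 1)"
      \<comment> \<open>The sign decides which of the two copies of the rise has a drawn North
        event, and so appears as a valley.\<close>
      proof (cases "0 \<le> area_entry p i")
        case True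
        have "prev (int (Suc i)) = int i" using i by (simp add: prev_def)
        moreover have "0 < key (int i)"
          using True i key_pos_iff[of "int i"] lev(1)[of i] by (auto simp: rows_def)
        ultimately have "\<sigma> (int i) < \<sigma> (int (Suc i))"
          using valley[of "int (Suc i)"] i lev(1)[of i] lev(1)[of "Suc i"] by (simp add: rows_def)
        then show ?thesis by (simp add: add.commute)
      next
        case False
        have prev: "prev (- int i) = - int (Suc i)" using i by (simp add: prev_def)
        have "0 < key (- int (Suc i))"
          using False i key_pos_iff[of "- int (Suc i)"] lev(2)[of "Suc i"] by (auto simp: rows_def)
        then have "\<sigma> (- int (Suc i)) < \<sigma> (- int i)"
          using valley[of "- int i"] i lev(2)[of i] lev(2)[of "Suc i"] unfolding prev by (simp add: rows_def)
        then show ?thesis using lev(3)[of i] lev(3)[of "Suc i"] i by (simp add: add.commute)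
      qed
    qed
    moreover have ?H
    proof
      assume "p \<noteq> [] \<and> hd p = North"
      then have "level 1 = 1" using hd by simp
      moreover obtain i where i: "i \<in> {1..2 * n}" "reading_order ! (i - 1) = 1" using reading_order_index[OF one] .
      ultimately show "0 < \<sigma> 1" using L last letter by fastforce
    qed
    ultimately show "?R \<and> ?H" ..
  next
    assume "?R \<and> ?H"
    then have R: ?R and H: ?H by blast+
    have ?V
    proof (intro allI impI)
      fix i j assume v: "is_valley (zeta_path n p) i j"
      define k where "k = reading_order ! (i - 1)"
      from v obtain m where ij: "i \<in> {1..2 * n}" "j \<in> {1..2 * n}" and m: "Suc m < 2 * n"
        "events ! m = (East, k)" "events ! Suc m = (North, reading_order ! (j - 1))"
        unfolding is_valley_iff k_def by blast
      note rise = valley_rise[OF m]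
      have "\<sigma> (prev k) < \<sigma> k"
        using rise(1)
      proof (cases rule: rows_cases)
        case (1 x)
        show ?thesis
        proof (cases "x = 1")
          case True
          \<comment> \<open>Here the predecessor is row -1, and oddness reduces the inequality to
            \<open>0 < \<sigma> 1\<close>.\<close>
          then have "level 1 = 1" using rise(3,4) 1 level_1 by (simp add: prev_def)
          then have "0 < \<sigma> 1" using H hd p by simp
          then show ?thesis using True 1 odd[OF one] by (simp add: prev_def)
        next
          case False
          define y where "y = x - 1"
          have y: "x = Suc y" "1 \<le> y" "y < n" "prev k = int y" using False 1 by (auto simp: y_def prev_def)
          then have "is_rise p y" using rise(3,4) 1 lev(1)[of y] lev(1)[of x] by (simp add: is_rise_iff)
          then show ?thesis using R y 1 by (simp add: add.commute)
        qed
      next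
        case (2 x)
        then have x: "x < n" "prev k = - int (Suc x)" using rise(2) by (auto simp: prev_def)
        have "is_rise p x"
          using rise(3,4) 2 x lev(2)[of x] lev(2)[of "Suc x"] by (simp add: is_rise_iff)
        then have "\<sigma> (int x) < \<sigma> (int (Suc x))" using R by (simp add: add.commute)
        then show ?thesis using lev(3)[of x] lev(3)[of "Suc x"] 2 x by simp
      qed
      then show "letter w i > letter w j" using letter ij rise(3) k_def by simp
    qed
    moreover have ?L using last letter H hd p by auto
    ultimately show "?V \<and> ?L" ..
  }
qed

text \<open>As an equivalence this shows both that images are correctly labelled and that a preimage
  found from path and word alone is correctly labelled.\<close>

lemma zeta_labelled_iff:
  assumes "\<sigma> \<in> signed_perms n"
  shows "zeta n (p, \<sigma>) \<in> diag_labelled_ballot_paths n \<longleftrightarrow> (p, \<sigma>) \<in> vert_labelled_paths n"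
proof -
  obtain \<rho> where \<rho>: "\<rho> \<in> signed_perms n" "map \<rho> rows_desc = reading_order"
    using reading_order_signed_perm .
  have "map \<sigma> reading_order = signed_word n (\<sigma> \<circ> \<rho>)"
    by (simp add: signed_word_eq \<rho>(2)[symmetric])
  then have "\<exists>\<tau> \<in> signed_perms n. map \<sigma> reading_order = signed_word n \<tau>"
    using signed_perms_comp[OF assms \<rho>(1)] by blast
  then show ?thesis
    using labelling_conditions_iff[OF assms] assms square zeta_path_ballot
    by (simp add: zeta_def zeta_word_eq diag_labelled_ballot_paths_def vert_labelled_paths_def)
qed

lemma zeta_word_inj:
  assumes "\<sigma> \<in> signed_perms n" "\<sigma>' \<in> signed_perms n" "zeta_word n p \<sigma> = zeta_word n p \<sigma>'"
  shows "\<sigma> = \<sigma>'"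
proof
  fix k
  show "\<sigma> k = \<sigma>' k"
  proof (cases "k \<in> rows")
    case True
    then show ?thesis using assms set_reading_order by (auto simp: zeta_word_eq map_eq_conv)
  next
    case False
    then show ?thesis using signed_permsD(1)[OF assms(1)] signed_permsD(1)[OF assms(2)] by (metis permutes_not_in)
  qed
qed

lemma zeta_word_surj:
  assumes "\<tau> \<in> signed_perms n"
  obtains \<sigma> where "\<sigma> \<in> signed_perms n" "zeta_word n p \<sigma> = signed_word n \<tau>"
proof -
  obtain \<rho> where \<rho>: "\<rho> \<in> signed_perms n" "map \<rho> rows_desc = reading_order"
    using reading_order_signed_perm .
  have comp: "\<tau> \<circ> inv \<rho> \<in> signed_perms n" by (intro signed_perms_comp signed_perms_inv assms \<rho>)
  have "map (\<tau> \<circ> inv \<rho>) reading_order = map \<tau> rows_desc"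
    using permutes_inverses(2)[OF signed_permsD(1)[OF \<rho>(1)]] by (simp add: \<rho>(2)[symmetric])
  then show thesis using that[OF comp] zeta_word_eq[OF comp] by (simp add: signed_word_eq)
qed

end

text \<open>An injection between finite sets of equal size, by \<open>zeta_path_inj\<close> and
  \<open>card_ballot_paths\<close>.\<close>

lemma zeta_path_bij:
  assumes "1 \<le> n"
  shows "bij_betw (zeta_path n) (square_paths n) (ballot_paths n)"
proof -
  have sub: "zeta_path n ` square_paths n \<subseteq> ballot_paths n"
    using square_path.zeta_path_ballot[of n] assms by (auto simp: square_path_def)
  moreover have "card (zeta_path n ` square_paths n) = card (ballot_paths n)"
    using card_image[OF zeta_path_inj[OF assms]] card_ballot_paths by simp
  ultimately have "zeta_path n ` square_paths n = ballot_paths n"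
    by (rule card_subset_eq[OF finite_ballot_paths])
  with zeta_path_inj[OF assms] show ?thesis by (simp add: bij_betw_def)
qed

theorem theorem4p2:
  fixes n :: nat
  assumes "n \<ge> 1"
  shows "bij_betw (zeta n) (vert_labelled_paths n) (diag_labelled_ballot_paths n) \<and>
    (\<forall>(p, \<sigma>) \<in> vert_labelled_paths n. dinv' n (p, \<sigma>) = area' n (zeta n (p, \<sigma>)))"
proof
  have loc: "square_path n p" if "p \<in> square_paths n" for p using assms that by unfold_locales
  have vert: "p \<in> square_paths n" "\<sigma> \<in> signed_perms n" if "(p, \<sigma>) \<in> vert_labelled_paths n" for p \<sigma>
    using that by (auto simp: vert_labelled_paths_def)
  show "bij_betw (zeta n) (vert_labelled_paths n) (diag_labelled_ballot_paths n)"
  proof (rule bij_betw_imageI)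
    show "inj_on (zeta n) (vert_labelled_paths n)"
    proof (rule inj_onI, clarify)
      fix p \<sigma> p' \<sigma>'
      assume v: "(p, \<sigma>) \<in> vert_labelled_paths n" "(p', \<sigma>') \<in> vert_labelled_paths n"
        and eq: "zeta n (p, \<sigma>) = zeta n (p', \<sigma>')"
      have "p = p'"
        using inj_onD[OF zeta_path_inj[OF assms], of p p'] vert[OF v(1)] vert[OF v(2)] eq by (simp add: zeta_def)
      moreover from this have "\<sigma> = \<sigma>'"
        using square_path.zeta_word_inj[OF loc] vert[OF v(1)] vert[OF v(2)] eq by (auto simp: zeta_def)
      ultimately show "p = p' \<and> \<sigma> = \<sigma>'" ..
    qed
    show "zeta n ` vert_labelled_paths n = diag_labelled_ballot_paths n"
    proof (intro equalityI subsetI)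
      fix x assume "x \<in> zeta n ` vert_labelled_paths n"
      then show "x \<in> diag_labelled_ballot_paths n"
        using square_path.zeta_labelled_iff[OF loc] vert by auto
    next
      fix x assume x: "x \<in> diag_labelled_ballot_paths n"
      then obtain \<beta> \<tau> where \<beta>: "\<beta> \<in> ballot_paths n" and \<tau>: "\<tau> \<in> signed_perms n"
        and eq: "x = (\<beta>, signed_word n \<tau>)"
        by (auto simp: diag_labelled_ballot_paths_def)
      \<comment> \<open>Path and labelling are inverted in turn: \<open>\<beta>\<close> determines
        \<open>p\<close>, and for this \<open>p\<close> the word determines
        \<open>\<sigma>\<close>.\<close>
      obtain p where p: "p \<in> square_paths n" "zeta_path n p = \<beta>"
        using zeta_path_bij[OF assms] \<beta> by (metis bij_betw_imp_surj_on imageE)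
      obtain \<sigma> where \<sigma>: "\<sigma> \<in> signed_perms n" "zeta_word n p \<sigma> = signed_word n \<tau>"
        using square_path.zeta_word_surj[OF loc[OF p(1)] \<tau>] .
      have "x = zeta n (p, \<sigma>)" using eq p \<sigma> by (simp add: zeta_def)
      then show "x \<in> zeta n ` vert_labelled_paths n"
        using x square_path.zeta_labelled_iff[OF loc[OF p(1)] \<sigma>(1)] by auto
    qed
  qed
  show "\<forall>(p, \<sigma>) \<in> vert_labelled_paths n. dinv' n (p, \<sigma>) = area' n (zeta n (p, \<sigma>))"
  proof clarify
    fix p \<sigma> assume v: "(p, \<sigma>) \<in> vert_labelled_paths n"
    interpret square_path n p by (rule loc[OF vert(1)[OF v]])
    show "dinv' n (p, \<sigma>) = area' n (zeta n (p, \<sigma>))"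
      using dinv'_eq_area'[of \<sigma>] signed_permsD(2)[OF vert(2)[OF v]] zeta_word_eq[OF vert(2)[OF v]]
      by (simp add: zeta_def)
  qed
qed

end
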